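(* Assume $\mathbb E|Z|<\infty$ and let $h:\mathbb R\to\mathbb R$ with $h\in L^1(p)$. On $\mathcal I_p$ the following identities hold, each one whenever the derivatives and integrals appearing in it exist and the kernel hypotheses $\mathrm H$ (see context) needed for it hold, namely: (1) needs only $h\in L^1(p)$; (2),(3) need $\mathrm H(0,0;h)$; (4) needs also $\mathrm H(1,0;h)$; (5),(6) need also $\mathrm H(1,1;h')$; (7),(8) need also $\mathrm H(2,1;h')$. \begin{align*} &(1)\quad f_{p,w,h}(x)=\mathbb E[K_{p,w}^{0,0}(x,Z)h(Z)],\\ &(2)\quad f_{p,w,h}(x)=\mathbb E[K_{p,w}^{0,1}(x,Z)h'(Z)],\\ &(3)\quad f_{p,w,h}'(x)=\mathbb E[K_{p,w}^{1,0}(x,Z)(h(Z)-h(x))],\\ &(4)\quad f_{p,w,h}'(x)=\mathbb E[K_{p,w}^{1,1}(x,Z)h'(Z)],\\ &(5)\quad f_{p,w,h}'(x)=\mathbb E[K_{p,w}^{1,2}(x,Z)h''(Z)]-\Big(\frac{\tau_p}{w}\Big)'(x)\,h'(x),\\ &(6)\quad f_{p,w,h}''(x)=\mathbb E[K_{p,w}^{2,1}(x,Z)h'(Z)]+\frac1{w(x)}h'(x),\\ &(7)\quad f_{p,w,h}''(x)=\mathbb E[K_{p,w}^{2,2}(x,Z)h''(Z)]-\Big(\frac{\tau_p}{w}\Big)''(x)\,h'(x),\\ &(8)\quad f_{p,w,h}''(x)=\mathbb E[K_{p,w}^{2,1}(x,Z)(h'(Z)-h'(x))]-\Big(\frac{\tau_p}{w}\Big)''(x)\,h'(x).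 \end{align*}
   Context: Setting. $p$ is a probability density on $\mathbb R$ and $Z$ a random variable with density $p$. There are $m\ge1$ and $-\infty\le l=e_0<e_1<\dots<e_m=u\le\infty$ with $\{p>0\}=\mathcal I_p:=\bigcup_{r=1}^m(e_{r-1},e_r)$, and $p$ is locally absolutely continuous on each $(e_{r-1},e_r)$. The weight $w:\mathbb R\to\mathbb R$ is nonzero on $\mathcal I_p$ and $wp$ is locally absolutely continuous on each $(e_{r-1},e_r)$. Put $P(x)=\int_l^xp$, $\overline P(x)=\int_x^up$, $\mathcal Ph=\mathbb E[h(Z)]$. For $h\in L^1(p)$, $f_{p,w,h}(x)=\frac1{w(x)p(x)}\int_l^x(h(t)-\mathcal Ph)p(t)\,dt$, $x\in\mathcal I_p$. With $\mu=\mathbb E Z$, the Stein kernel is $\tau_p(x)=\frac1{p(x)}\int_l^x(\mu-t)p(t)\,dt$, $x\in\mathcal I_p$. Kernels. $\underline m_{p,w}=P/(wp)$ and $\overline m_{p,w}=\overline P/(wp)$ on $\mathcal I_p$; $\underline P_0=\overline P_0=p$ and, for $j\ge1$, $\underline P_j(x)=\int_l^x\underline P_{j-1}(t)\,dt$, $\overline P_j(x)=\int_x^u\overline P_{j-1}(t)\,dt$. For $i,j\ge0$ and $x,v\in\mathcal I_p$, $$K_{p,w}^{i,j}(x,v)=\frac1{p(v)}\Big[(-1)^j\overline m_{p,w}^{(i)}(x)\underline P_j(v)\mathbf 1_{\{v\le x\}}-\underline m_{p,w}^{(i)}(x)\overline P_j(v)\mathbf 1_{\{v>x\}}\Big].$$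 Kernel hypotheses $\mathrm H(i,j;g)$, for integers $i,j\ge0$ and $g:\mathbb R\to\mathbb R$: for every $x\in\mathcal I_p$, (a) $\underline P_{j+1}(x),\overline P_{j+1}(x)$ are finite; (b) the derivatives of $\underline m_{p,w},\overline m_{p,w}$ through order $i+1$ are finite and locally absolutely continuous near $x$; (c) $g$ is locally absolutely continuous and $\mathbb E[|K_{p,w}^{i,j}(x,Z)g(Z)|+|K_{p,w}^{i,j+1}(x,Z)g'(Z)|+|K_{p,w}^{i+1,j}(x,Z)g(Z)|]<\infty$; (d) $g(v)P(v)\to0$ and $g(v)\underline P_{j+1}(v)\to0$ as $v\downarrow l$, and $g(v)\overline P(v)\to0$ and $g(v)\overline P_{j+1}(v)\to0$ as $v\uparrow u$. *)

theory Defs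
  imports "HOL-Probability.Probability"
begin

text \<open>
  The interval endpoints \<open>l\<close>, \<open>u\<close>, \<open>e 0\<close>, \ldots, \<open>e m\<close> are extended reals.  Expectations are taken over a
  probability space \<open>M\<close> carrying a random variable \<open>Z\<close> with density \<open>p\<close>.  All derivatives are
  \<^const>\<open>deriv\<close>; for a locally absolutely continuous function this is the derivative almost
  everywhere, and one fixed unspecified constant on the null set where no derivative exists.
\<close>

definition abs_continuous_Icc :: "real \<Rightarrow> real \<Rightarrow> (real \<Rightarrow> real) \<Rightarrow> bool" where
  "abs_continuous_Icc a b g \<longleftrightarrow>
    (\<forall>\<epsilon>>0. \<exists>\<delta>>0. \<forall>(n::nat) x y.
        (\<forall>k<n. a \<le> x k \<and> x k \<le> y k \<and> y k \<le> b) \<and>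
        disjoint_family_on (\<lambda>k. {x k<..<y k}) {..<n} \<and>
        (\<Sum>k<n. y k - x k) < \<delta> \<longrightarrow>
        (\<Sum>k<n. \<bar>g (y k) - g (x k)\<bar>) < \<epsilon>)"

definition locally_abs_continuous_on :: "real set \<Rightarrow> (real \<Rightarrow> real) \<Rightarrow> bool" where
  "locally_abs_continuous_on S g \<longleftrightarrow> (\<forall>a b. a \<le> b \<and> {a..b} \<subseteq> S \<longrightarrow> abs_continuous_Icc a b g)"

definition pieces :: "nat \<Rightarrow> (nat \<Rightarrow> ereal) \<Rightarrow> real set" where
  "pieces m e = (\<Union>r\<in>{1..m}. einterval (e (r - 1)) (e r))"

definition lower_P :: "ereal \<Rightarrow> (real \<Rightarrow> real) \<Rightarrow> real \<Rightarrow> real" where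
  "lower_P l p x = (LBINT t=l..ereal x. p t)"

definition upper_P :: "ereal \<Rightarrow> (real \<Rightarrow> real) \<Rightarrow> real \<Rightarrow> real" where
  "upper_P u p x = (LBINT t=ereal x..u. p t)"

text \<open>The iterated integrals of \<open>p\<close> may be infinite, hence the type \<^typ>\<open>ennreal\<close>.\<close>

primrec lower_Ps :: "ereal \<Rightarrow> (real \<Rightarrow> real) \<Rightarrow> nat \<Rightarrow> real \<Rightarrow> ennreal" where
  "lower_Ps l p 0 = (\<lambda>x. ennreal (p x))"
| "lower_Ps l p (Suc j) = (\<lambda>x. \<integral>\<^sup>+t\<in>einterval l (ereal x). lower_Ps l p j t \<partial>lborel)"

primrec upper_Ps :: "ereal \<Rightarrow> (real \<Rightarrow> real) \<Rightarrow> nat \<Rightarrow> real \<Rightarrow> ennreal" where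
  "upper_Ps u p 0 = (\<lambda>x. ennreal (p x))"
| "upper_Ps u p (Suc j) = (\<lambda>x. \<integral>\<^sup>+t\<in>einterval (ereal x) u. upper_Ps u p j t \<partial>lborel)"

definition lower_m :: "ereal \<Rightarrow> (real \<Rightarrow> real) \<Rightarrow> (real \<Rightarrow> real) \<Rightarrow> real \<Rightarrow> real" where
  "lower_m l p w x = lower_P l p x / (w x * p x)"

definition upper_m :: "ereal \<Rightarrow> (real \<Rightarrow> real) \<Rightarrow> (real \<Rightarrow> real) \<Rightarrow> real \<Rightarrow> real" where
  "upper_m u p w x = upper_P u p x / (w x * p x)"

definition stein_solution ::
  "'a measure \<Rightarrow> ('a \<Rightarrow> real) \<Rightarrow> ereal \<Rightarrow> (real \<Rightarrow> real) \<Rightarrow> (real \<Rightarrow> real) \<Rightarrow> (real \<Rightarrow> real) \<Rightarrow> real \<Rightarrow> real"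
where
  "stein_solution M Z l p w h x =
     1 / (w x * p x) * (LBINT t=l..ereal x. (h t - (LINT \<omega>|M. h (Z \<omega>))) * p t)"

definition stein_tau :: "'a measure \<Rightarrow> ('a \<Rightarrow> real) \<Rightarrow> ereal \<Rightarrow> (real \<Rightarrow> real) \<Rightarrow> real \<Rightarrow> real" where
  "stein_tau M Z l p x = 1 / p x * (LBINT t=l..ereal x. ((LINT \<omega>|M. Z \<omega>) - t) * p t)"

text \<open>
  The function \<open>K\<^sup>i\<^sup>,\<^sup>j(x,v)\<close>.  It is meaningful for \<open>x\<close>, \<open>v\<close> with positive density; \<open>Z\<close> takes
  other values with probability zero, and there \<open>1 / p v = 0\<close>.
\<close>

definition K_kernel ::
  "ereal \<Rightarrow> ereal \<Rightarrow> (real \<Rightarrow> real) \<Rightarrow> (real \<Rightarrow> real) \<Rightarrow> nat \<Rightarrow> nat \<Rightarrow> real \<Rightarrow> real \<Rightarrow> real"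
where
  "K_kernel l u p w i j x v =
     1 / p v *
       ((-1) ^ j * (deriv ^^ i) (upper_m u p w) x * enn2real (lower_Ps l p j v) * of_bool (v \<le> x)
        - (deriv ^^ i) (lower_m l p w) x * enn2real (upper_Ps u p j v) * of_bool (v > x))"

definition derivs_loc_abs_continuous_near :: "nat \<Rightarrow> (real \<Rightarrow> real) \<Rightarrow> real \<Rightarrow> bool" where
  "derivs_loc_abs_continuous_near n f x \<longleftrightarrow>
     (\<exists>\<epsilon>>0.
        (\<forall>k<n. \<forall>y\<in>{x-\<epsilon><..<x+\<epsilon>}. (deriv ^^ k) f differentiable (at y)) \<and>
        (\<forall>k\<le>n. locally_abs_continuous_on {x-\<epsilon><..<x+\<epsilon>} ((deriv ^^ k) f)))"

text \<open>
  The kernel hypotheses \<open>H(i,j;g)\<close>.  As in \<^theory>\<open>HOL-Analysis.Interval_Integral\<close>, the limits at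
  the possibly infinite endpoints are limits of \<open>f \<circ> real_of_ereal\<close> along filters on
  \<^typ>\<open>ereal\<close>.
\<close>

definition kernel_hyp ::
  "'a measure \<Rightarrow> ('a \<Rightarrow> real) \<Rightarrow> nat \<Rightarrow> (nat \<Rightarrow> ereal) \<Rightarrow> (real \<Rightarrow> real) \<Rightarrow> (real \<Rightarrow> real) \<Rightarrow>
    nat \<Rightarrow> nat \<Rightarrow> (real \<Rightarrow> real) \<Rightarrow> bool"
where
  "kernel_hyp M Z m e p w i j g \<longleftrightarrow>
    (let l = e 0; u = e m in
     \<forall>x\<in>pieces m e.
      (lower_Ps l p (j + 1) x < \<infinity> \<and> upper_Ps u p (j + 1) x < \<infinity>) \<and>
      (derivs_loc_abs_continuous_near (i + 1) (lower_m l p w) x \<and>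
       derivs_loc_abs_continuous_near (i + 1) (upper_m u p w) x) \<and>
      (locally_abs_continuous_on UNIV g \<and>
       integrable M (\<lambda>\<omega>. K_kernel l u p w i j x (Z \<omega>) * g (Z \<omega>)) \<and>
       integrable M (\<lambda>\<omega>. K_kernel l u p w i (j + 1) x (Z \<omega>) * deriv g (Z \<omega>)) \<and>
       integrable M (\<lambda>\<omega>. K_kernel l u p w (i + 1) j x (Z \<omega>) * g (Z \<omega>))) \<and>
      (((\<lambda>v. g v * lower_P l p v) \<circ> real_of_ereal) \<longlongrightarrow> 0) (at_right l) \<and>
      (((\<lambda>v. g v * enn2real (lower_Ps l p (j + 1) v)) \<circ> real_of_ereal) \<longlongrightarrow> 0) (at_right l) \<and>
      (((\<lambda>v. g v * upper_P u p v) \<circ> real_of_ereal) \<longlongrightarrow> 0) (at_left u) \<and>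
      (((\<lambda>v. g v * enn2real (upper_Ps u p (j + 1) v)) \<circ> real_of_ereal) \<longlongrightarrow> 0) (at_left u))"

end

theory Submission
  imports Defs
begin

text \<open>
  A locally absolutely continuous \<open>g\<close> is a difference of two nondecreasing locally absolutely
  continuous functions (its variation and the variation minus \<open>g\<close>).  Their Stieltjes measures are
  absolutely continuous with respect to Lebesgue measure, so Radon--Nikodym gives a density of \<open>g\<close>,
  and Lebesgue's differentiation theorem identifies it almost everywhere with the derivative.

  Fubini's theorem then yields, with \<open>g'\<close> any density of \<open>g\<close>,
  \<open>\<integral>\<^sub>l\<^sup>x P\<^sub>j\<^sub>+\<^sub>1 g' = g(x) P\<^sub>j\<^sub>+\<^sub>1(x) - \<integral>\<^sub>l\<^sup>x P\<^sub>j g\<close> and its mirror image; absolute convergence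
  of the left-hand side makes boundary terms at the end points superfluous.  With
  \<open>L = \<integral>\<^sub>l\<^sup>x h p\<close> and \<open>U = \<integral>\<^sub>x\<^sup>u h p\<close> the Stein solution is
  \<open>m\<^sub>U L - m\<^sub>L U\<close>, where \<open>m\<^sub>U\<close>, \<open>m\<^sub>L\<close> are the upper and lower kernels.  From \<open>m\<^sub>U P = m\<^sub>L (1 - P)\<close> one gets
  \<open>m\<^sub>U' P - m\<^sub>L' (1 - P) = - 1 / w\<close>, so its first two derivatives are
  \<open>m\<^sub>U' (L - h P) - m\<^sub>L' (U - h (1 - P))\<close> and the same expression with second derivatives of the kernels
  plus \<open>h' / w\<close>.  Integration by parts turns each of the expectations into such expressions; the correction
  terms come from \<open>\<tau>\<^sub>p / w = m\<^sub>U P\<^sub>2 + m\<^sub>L Q\<^sub>2\<close>, where \<open>P\<^sub>2\<close>, \<open>Q\<^sub>2\<close> are the twice iterated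
  lower and upper integrals of \<open>p\<close>.
\<close>

section \<open>Variation of a locally absolutely continuous function\<close>

text \<open>Sets of pairs instead of the indexed sequences of \<open>abs_continuous_Icc\<close>, so
  that families can be united and refined as sets. The strict inequality excludes empty intervals,
  hence pairs with disjoint intervals are automatically different.\<close>

definition interval_family :: "(real \<times> real) set \<Rightarrow> bool" where
  "interval_family D \<longleftrightarrow> finite D \<and> (\<forall>(s, t)\<in>D. s < t) \<and> disjoint_family_on (\<lambda>(s, t). {s<..<t}) D"

definition families :: "real \<Rightarrow> real \<Rightarrow> (real \<times> real) set set" where
  "families a b = {D. interval_family D \<and> (\<forall>(s, t)\<in>D. a \<le> s \<and> t \<le> b)}"

definition var_sum :: "(real \<Rightarrow> real) \<Rightarrow> (real \<times> real) set \<Rightarrow> real" where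
  "var_sum g D = (\<Sum>(s, t)\<in>D. \<bar>g t - g s\<bar>)"

text \<open>A supremum of reals, meaningful only together with the boundedness shown in
  \<open>var_sum_bounded\<close>. For \<open>b \<le> a\<close> the empty family is the only one and
  the value is 0.\<close>

definition variation :: "(real \<Rightarrow> real) \<Rightarrow> real \<Rightarrow> real \<Rightarrow> real" where
  "variation g a b = (SUP D\<in>families a b. var_sum g D)"

text \<open>Absolute continuity on every compact interval; \<^term>\<open>var_sum id D\<close> is the total length of \<open>D\<close>.\<close>

definition small_variation :: "(real \<Rightarrow> real) \<Rightarrow> bool" where
  "small_variation g \<longleftrightarrow>
    (\<forall>a b. \<forall>\<epsilon>>0. \<exists>\<delta>>0. \<forall>D\<in>families a b. var_sum id D < \<delta> \<longrightarrow> var_sum g D < \<epsilon>)"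

lemma familiesD:
  assumes "D \<in> families a b"
  shows "finite D" "(s, t) \<in> D \<Longrightarrow> s < t" "(s, t) \<in> D \<Longrightarrow> a \<le> s" "(s, t) \<in> D \<Longrightarrow> t \<le> b"
    "disjoint_family_on (\<lambda>(s, t). {s<..<t}) D"
  using assms by (auto simp: families_def interval_family_def)

lemma familiesD_disjoint:
  assumes "D \<in> families a b" "d \<in> D" "d' \<in> D" "d \<noteq> d'"
  shows "{fst d<..<snd d} \<inter> {fst d'<..<snd d'} = {}"
  using familiesD(5)[OF assms(1)] assms(2-4) by (auto simp: disjoint_family_on_def split_beta)

lemma familiesI:
  assumes "finite D" "\<And>s t. (s, t) \<in> D \<Longrightarrow> s < t \<and> a \<le> s \<and> t \<le> b"
    and "\<And>d d'. d \<in> D \<Longrightarrow> d' \<in> D \<Longrightarrow> d \<noteq> d' \<Longrightarrow> {fst d<..<snd d} \<inter> {fst d'<..<snd d'} = {}"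
  shows "D \<in> families a b"
  using assms by (auto simp: families_def interval_family_def disjoint_family_on_def split_beta)

lemma empty_in_families [simp]: "{} \<in> families a b"
  by (rule familiesI) auto

lemma families_mono: "D \<in> families a b \<Longrightarrow> a' \<le> a \<Longrightarrow> b \<le> b' \<Longrightarrow> D \<in> families a' b'"
  by (force simp: families_def)

text \<open>A bijection with \<open>{..<card D}\<close> turns a family into the indexed sequences of
  the definition. For \<open>b < a\<close> only the empty family exists, and its sum is 0.\<close>

lemma loc_abs_continuous_imp_small_variation:
  assumes "locally_abs_continuous_on UNIV g"
  shows "small_variation g"
  unfolding small_variation_def
proof (intro allI impI)
  fix a b \<epsilon> :: real assume "\<epsilon> > 0"
  show "\<exists>\<delta>>0. \<forall>D\<in>families a b. var_sum id D < \<delta> \<longrightarrow> var_sum g D < \<epsilon>"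
  proof (cases "a \<le> b")
    case False
    then have empty: "D = {}" if "D \<in> families a b" for D
      using familiesD(2-4)[OF that] by fastforce
    then have "var_sum g D = 0" if "D \<in> families a b" for D
      using empty[OF that] by (simp add: var_sum_def)
    then show ?thesis using \<open>\<epsilon> > 0\<close> by (intro exI[of _ 1]) auto
  next
    case True
    with assms have "abs_continuous_Icc a b g" by (auto simp: locally_abs_continuous_on_def)
    then obtain \<delta> where \<delta>: "\<delta> > 0" and *: "\<And>(n::nat) x y.
        (\<forall>k<n. a \<le> x k \<and> x k \<le> y k \<and> y k \<le> b) \<Longrightarrow>
        disjoint_family_on (\<lambda>k. {x k<..<y k}) {..<n} \<Longrightarrow>
        (\<Sum>k<n. y k - x k) < \<delta> \<Longrightarrow> (\<Sum>k<n. \<bar>g (y k) - g (x k)\<bar>) < \<epsilon>"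
      unfolding abs_continuous_Icc_def using \<open>\<epsilon> > 0\<close> by meson
    show ?thesis
    proof (intro exI[of _ \<delta>] conjI ballI impI \<delta>)
      fix D assume D: "D \<in> families a b" and len: "var_sum id D < \<delta>"
      obtain \<phi> where \<phi>: "bij_betw \<phi> {..<card D} D"
        using ex_bij_betw_nat_finite[OF familiesD(1)[OF D]] by (auto simp: atLeast0LessThan)
      have D': "\<phi> k \<in> D" if "k < card D" for k using \<phi> that by (auto simp: bij_betw_def)
      have inD: "a \<le> fst (\<phi> k)" "fst (\<phi> k) < snd (\<phi> k)" "snd (\<phi> k) \<le> b" if "k < card D" for k
        using familiesD(2-4)[OF D] D'[OF that] by (metis prod.collapse)+
      have re: "(\<Sum>k<card D. \<bar>q (snd (\<phi> k)) - q (fst (\<phi> k))\<bar>) = var_sum q D" for q :: "real \<Rightarrow> real"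
        unfolding var_sum_def by (subst sum.reindex_bij_betw[OF \<phi>, symmetric]) (simp add: split_beta)
      have "(\<Sum>k<card D. \<bar>g (snd (\<phi> k)) - g (fst (\<phi> k))\<bar>) < \<epsilon>"
      proof (rule *)
        show "\<forall>k<card D. a \<le> fst (\<phi> k) \<and> fst (\<phi> k) \<le> snd (\<phi> k) \<and> snd (\<phi> k) \<le> b"
          using inD by (auto intro: less_imp_le)
        show "disjoint_family_on (\<lambda>k. {fst (\<phi> k)<..<snd (\<phi> k)}) {..<card D}"
          unfolding disjoint_family_on_def
        proof (intro ballI impI)
          fix i j assume "i \<in> {..<card D}" "j \<in> {..<card D}" "i \<noteq> j"
          then have "\<phi> i \<noteq> \<phi> j" using \<phi> by (auto simp: bij_betw_def inj_on_def)
          then show "{fst (\<phi> i)<..<snd (\<phi> i)} \<inter> {fst (\<phi> j)<..<snd (\<phi> j)} = {}"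
            using familiesD_disjoint[OF D D' D'] \<open>i \<in> _\<close> \<open>j \<in> _\<close> by blast
        qed
        have "(\<Sum>k<card D. snd (\<phi> k) - fst (\<phi> k)) = var_sum id D"
          unfolding re[symmetric] using inD by (intro sum.cong) (auto simp: less_imp_le abs_of_pos)
        then show "(\<Sum>k<card D. snd (\<phi> k) - fst (\<phi> k)) < \<delta>" using len by simp
      qed
      then show "var_sum g D < \<epsilon>" unfolding re .
    qed
  qed
qed

section \<open>Cutting, measuring and refining families of intervals\<close>

text \<open>Every interval is cut at \<open>b\<close> by the maps \<open>min _ b\<close> and
  \<open>max _ b\<close>. The increment of \<open>g\<close> over an interval is the sum of its
  increments over the two parts, so the triangle inequality gives the bound.\<close>

lemma families_split:
  assumes D: "D \<in> families a c" and "a \<le> b" "b \<le> c"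
  obtains D1 D2 where "D1 \<in> families a b" "D2 \<in> families b c"
    "var_sum g D \<le> var_sum g D1 + var_sum g D2"
proof -
  have fin: "finite D" using D by (rule familiesD)
  \<comment> \<open>\<open>q\<close> is the projection onto one of the two halves; pairs that it collapses are dropped.\<close>
  have clip: "\<exists>D'. D' \<in> families a' c' \<and> var_sum g D' = (\<Sum>(s, t)\<in>D. \<bar>g (q t) - g (q s)\<bar>)"
    if mono_q: "\<And>x y. x \<le> y \<Longrightarrow> q x \<le> q y" and open_q: "\<And>x s t. s \<le> t \<Longrightarrow> q s < x \<Longrightarrow> x < q t \<Longrightarrow> s < x \<and> x < t"
      and range: "\<And>x. a \<le> x \<Longrightarrow> x \<le> c \<Longrightarrow> a' \<le> q x \<and> q x \<le> c'" for q a' c'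
  proof -
    define N where "N = {(s, t) \<in> D. q s < q t}"
    define D' where "D' = (\<lambda>(s, t). (q s, q t)) ` N"
    have "finite N" unfolding N_def using fin by (rule finite_subset[rotated]) auto
    \<comment> \<open>A point strictly between the images of the endpoints lies, by
      \<open>open_q\<close>, inside the original interval. Since the intervals of \<open>D\<close>
      are disjoint, it determines its interval; this yields both injectivity on \<open>N\<close> and
      disjointness of the images.\<close>
    have same: "d = d'" if "d \<in> N" "d' \<in> N" "q (fst d) < x" "x < q (snd d)" "q (fst d') < x" "x < q (snd d')" for d d' x
    proof (rule ccontr)
      assume "d \<noteq> d'"
      have "d \<in> D" "d' \<in> D" using that by (auto simp: N_def)
      then have "fst d \<le> snd d" "fst d' \<le> snd d'" using familiesD(2)[OF D] by (metis prod.collapse less_imp_le)+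
      then have "x \<in> {fst d<..<snd d} \<inter> {fst d'<..<snd d'}"
        using open_q that by auto
      then show False using familiesD_disjoint[OF D \<open>d \<in> D\<close> \<open>d' \<in> D\<close> \<open>d \<noteq> d'\<close>] by auto
    qed
    have inj: "inj_on (\<lambda>(s, t). (q s, q t)) N"
    proof (rule inj_onI)
      fix d d' assume dd: "d \<in> N" "d' \<in> N" and eq: "(case d of (s, t) \<Rightarrow> (q s, q t)) = (case d' of (s, t) \<Rightarrow> (q s, q t))"
      then have "q (fst d) < q (snd d)" by (auto simp: N_def)
      then obtain x where "q (fst d) < x" "x < q (snd d)" using dense by blast
      then show "d = d'" using same[OF dd, of x] eq by (auto simp: split_beta)
    qed
    have "D' \<in> families a' c'"
    proof (rule familiesI)
      show "finite D'" unfolding D'_def using \<open>finite N\<close> by simp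
      show "s < t \<and> a' \<le> s \<and> t \<le> c'" if st: "(s, t) \<in> D'" for s t
      proof -
        obtain s' t' where d: "(s', t') \<in> D" "q s' < q t'" "s = q s'" "t = q t'"
          using st by (auto simp: D'_def N_def)
        have "a \<le> s'" "s' < t'" "t' \<le> c" using familiesD[OF D] d by auto
        then show ?thesis using d range[of s'] range[of t'] by auto
      qed
      show "{fst d<..<snd d} \<inter> {fst d'<..<snd d'} = {}" if dd: "d \<in> D'" "d' \<in> D'" "d \<noteq> d'" for d d'
      proof (rule ccontr)
        assume "\<not> ?thesis"
        then obtain x where "x \<in> {fst d<..<snd d} \<inter> {fst d'<..<snd d'}" by blast
        then have x: "fst d < x" "x < snd d" "fst d' < x" "x < snd d'" by auto
        obtain e where e: "e \<in> N" "d = (q (fst e), q (snd e))" using dd by (force simp: D'_def)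
        obtain e' where e': "e' \<in> N" "d' = (q (fst e'), q (snd e'))" using dd by (force simp: D'_def)
        from same[OF e(1) e'(1), of x] x e e' have "e = e'" by simp
        with e e' dd show False by simp
      qed
    qed
    moreover have "var_sum g D' = (\<Sum>(s, t)\<in>N. \<bar>g (q t) - g (q s)\<bar>)"
      unfolding var_sum_def D'_def using inj by (subst sum.reindex) (auto simp: split_beta)
    moreover have "\<dots> = (\<Sum>(s, t)\<in>D. \<bar>g (q t) - g (q s)\<bar>)"
    proof (rule sum.mono_neutral_left[OF fin])
      show "N \<subseteq> D" by (auto simp: N_def)
      show "\<forall>i\<in>D - N. (case i of (s, t) \<Rightarrow> \<bar>g (q t) - g (q s)\<bar>) = 0"
      proof
        fix d assume "d \<in> D - N"
        then have "fst d < snd d" "\<not> q (fst d) < q (snd d)"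
          using familiesD(2)[OF D, of "fst d" "snd d"] by (auto simp: N_def split_beta)
        then have "q (snd d) = q (fst d)" using mono_q[of "fst d" "snd d"] by simp
        then show "(case d of (s, t) \<Rightarrow> \<bar>g (q t) - g (q s)\<bar>) = 0" by (simp add: split_beta)
      qed
    qed
    ultimately show ?thesis by metis
  qed
  have "\<exists>D1. D1 \<in> families a b \<and> var_sum g D1 = (\<Sum>(s, t)\<in>D. \<bar>g (min t b) - g (min s b)\<bar>)"
    by (rule clip) (use assms in \<open>auto simp: min_def split: if_splits\<close>)
  then obtain D1 where D1: "D1 \<in> families a b" "var_sum g D1 = (\<Sum>(s, t)\<in>D. \<bar>g (min t b) - g (min s b)\<bar>)"
    by blast
  have "\<exists>D2. D2 \<in> families b c \<and> var_sum g D2 = (\<Sum>(s, t)\<in>D. \<bar>g (max t b) - g (max s b)\<bar>)"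
    by (rule clip) (use assms in \<open>auto simp: max_def split: if_splits\<close>)
  then obtain D2 where D2: "D2 \<in> families b c" "var_sum g D2 = (\<Sum>(s, t)\<in>D. \<bar>g (max t b) - g (max s b)\<bar>)"
    by blast
  have "var_sum g D \<le> var_sum g D1 + var_sum g D2"
    unfolding D1(2) D2(2) unfolding var_sum_def sum.distrib[symmetric]
    by (rule sum_mono) (auto simp: min_def max_def)
  with D1 D2 that show ?thesis by blast
qed

text \<open>The total length is the Lebesgue measure of a disjoint union contained in
  \<open>{a..b}\<close>.\<close>

lemma var_sum_id_le:
  assumes D: "D \<in> families a b" and "a \<le> b"
  shows "var_sum id D \<le> b - a"
proof -
  have "var_sum id D = (\<Sum>d\<in>D. measure lborel {fst d<..<snd d})"
    unfolding var_sum_def using familiesD(2)[OF D]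
    by (intro sum.cong) (auto simp: less_imp_le abs_of_pos)
  also have "\<dots> = measure lborel (\<Union>d\<in>D. {fst d<..<snd d})"
  proof (rule measure_finite_Union[symmetric])
    show "disjoint_family_on (\<lambda>d. {fst d<..<snd d}) D"
      using familiesD_disjoint[OF D] by (auto simp: disjoint_family_on_def)
    fix d assume "d \<in> D"
    then have "fst d \<le> snd d" using familiesD(2)[OF D] by (metis prod.collapse less_imp_le)
    then show "emeasure lborel {fst d<..<snd d} \<noteq> \<infinity>" by simp
  qed (use familiesD(1)[OF D] in auto)
  also have "\<dots> \<le> measure lborel {a..b}"
  proof (rule measure_mono_fmeasurable)
    show "(\<Union>d\<in>D. {fst d<..<snd d}) \<subseteq> {a..b}"
      using familiesD(3,4)[OF D] by force
    show "(\<Union>d\<in>D. {fst d<..<snd d}) \<in> sets lborel"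
      using familiesD(1)[OF D] by auto
    show "{a..b} \<in> fmeasurable lborel"
      using \<open>a \<le> b\<close> by (intro fmeasurableI) auto
  qed
  finally show ?thesis using \<open>a \<le> b\<close> by simp
qed

text \<open>Refinement: each interval \<open>d\<close> is replaced by a family \<open>E d\<close>
  inside it. Intervals coming from different members are disjoint because the members are, and no
  pair is counted twice because pairs are nondegenerate.\<close>

lemma families_join:
  assumes D: "D \<in> families a b" and E: "\<And>d. d \<in> D \<Longrightarrow> E d \<in> families (fst d) (snd d)"
  shows "(\<Union>d\<in>D. E d) \<in> families a b" "var_sum g (\<Union>d\<in>D. E d) = (\<Sum>d\<in>D. var_sum g (E d))"
proof -
  have sub: "fst d \<le> fst d'" "fst d' < snd d'" "snd d' \<le> snd d" if "d \<in> D" "d' \<in> E d" for d d'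
    using familiesD(2-4)[OF E[OF that(1)]] that by (metis prod.collapse)+
  have disj: "{fst d<..<snd d} \<inter> {fst d'<..<snd d'} = {}"
    if "d \<in> E i" "d' \<in> E j" "i \<in> D" "j \<in> D" "i \<noteq> j" for d d' i j
    using familiesD_disjoint[OF D \<open>i \<in> D\<close> \<open>j \<in> D\<close> \<open>i \<noteq> j\<close>] sub[OF \<open>i \<in> D\<close> \<open>d \<in> E i\<close>] sub[OF \<open>j \<in> D\<close> \<open>d' \<in> E j\<close>]
    by force
  show "(\<Union>d\<in>D. E d) \<in> families a b"
  proof (rule familiesI)
    show "finite (\<Union>d\<in>D. E d)" using familiesD(1)[OF D] familiesD(1)[OF E] by auto
    show "s < t \<and> a \<le> s \<and> t \<le> b" if st: "(s, t) \<in> (\<Union>d\<in>D. E d)" for s t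
    proof -
      obtain d where d: "d \<in> D" "(s, t) \<in> E d" using st by blast
      then have "a \<le> fst d" "snd d \<le> b" using familiesD(3,4)[OF D] by (metis prod.collapse)+
      then show ?thesis using sub[OF d] by auto
    qed
    show "{fst d<..<snd d} \<inter> {fst d'<..<snd d'} = {}"
      if dd: "d \<in> (\<Union>d\<in>D. E d)" "d' \<in> (\<Union>d\<in>D. E d)" "d \<noteq> d'" for d d'
    proof -
      obtain i j where ij: "i \<in> D" "d \<in> E i" "j \<in> D" "d' \<in> E j" using dd by auto
      show ?thesis
      proof (cases "i = j")
        case True
        then show ?thesis using familiesD_disjoint[OF E[OF ij(1)]] ij dd by blast
      next
        case False
        then show ?thesis using disj ij by blast
      qed
    qed
  qed
  show "var_sum g (\<Union>d\<in>D. E d) = (\<Sum>d\<in>D. var_sum g (E d))"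
    unfolding var_sum_def
  proof (rule sum.UNION_disjoint)
    show "finite D" using familiesD(1)[OF D] .
    show "\<forall>i\<in>D. finite (E i)" using familiesD(1)[OF E] by auto
    show "\<forall>i\<in>D. \<forall>j\<in>D. i \<noteq> j \<longrightarrow> E i \<inter> E j = {}"
    proof (intro ballI impI, rule ccontr)
      fix i j assume ij: "i \<in> D" "j \<in> D" "i \<noteq> j" "E i \<inter> E j \<noteq> {}"
      then obtain d where d: "d \<in> E i" "d \<in> E j" by auto
      then have "{fst d<..<snd d} = {}" using disj[OF d ij(1-3)] by simp
      then show False using sub[OF ij(1) d(1)] by simp
    qed
  qed
qed

text \<open>Bisection with \<open>Bolzano\<close>: bounds on adjacent intervals add up by
  \<open>families_split\<close>. Near a point, an interval shorter than 1 and than the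
  \<open>\<delta>\<close> belonging to the bound 1 admits only families of total length below
  \<open>\<delta>\<close>, whose sums are therefore below 1.\<close>

lemma var_sum_bounded:
  assumes "small_variation g"
  shows "bdd_above (var_sum g ` families a b)"
proof (cases "a \<le> b")
  case False
  then have "families a b = {{}}"
    using familiesD(2-4) by (fastforce dest: order_less_imp_le order_trans)
  then show ?thesis by simp
next
  case True
  then show ?thesis
  proof (induction rule: Bolzano)
    case (trans a b c)
    then obtain K L where KL: "\<And>D. D \<in> families a b \<Longrightarrow> var_sum g D \<le> K"
      "\<And>D. D \<in> families b c \<Longrightarrow> var_sum g D \<le> L"
      by (auto simp: bdd_above_def)
    have "var_sum g D \<le> K + L" if D: "D \<in> families a c" for D
    proof -
      obtain D1 D2 where "D1 \<in> families a b" "D2 \<in> families b c" "var_sum g D \<le> var_sum g D1 + var_sum g D2"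
        using families_split[OF D] trans by metis
      then show ?thesis using KL by fastforce
    qed
    then show ?case by (auto simp: bdd_above_def)
  next
    case (local x)
    obtain \<delta> where \<delta>: "\<delta> > 0" "\<And>D. D \<in> families (x - 1) (x + 1) \<Longrightarrow> var_sum id D < \<delta> \<Longrightarrow> var_sum g D < 1"
      using assms unfolding small_variation_def by (metis zero_less_one)
    have "bdd_above (var_sum g ` families a b)" if ab: "a \<le> x" "x \<le> b" "b - a < min \<delta> 1" for a b
    proof -
      have "var_sum g D \<le> 1" if D: "D \<in> families a b" for D
        using \<delta>(2)[of D] families_mono[OF D, of "x - 1" "x + 1"] var_sum_id_le[OF D] ab by simp
      then show ?thesis by (auto simp: bdd_above_def)
    qed
    then show ?case using \<open>\<delta> > 0\<close> by (intro exI[of _ "min \<delta> 1"]) auto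
  qed
qed

section \<open>Additivity of the variation and decomposition into monotone functions\<close>

lemma variation_upper:
  assumes "small_variation g" "D \<in> families a b"
  shows "var_sum g D \<le> variation g a b"
  unfolding variation_def using assms by (intro cSUP_upper var_sum_bounded)

lemma variation_least:
  assumes "\<And>D. D \<in> families a b \<Longrightarrow> var_sum g D \<le> K"
  shows "variation g a b \<le> K"
  unfolding variation_def using assms by (intro cSUP_least) (auto intro: empty_in_families)

lemma variation_nonneg: "small_variation g \<Longrightarrow> 0 \<le> variation g a b"
  using variation_upper[of g "{}" a b] by (simp add: var_sum_def)

text \<open>One inequality cuts a family at \<open>b\<close>. The other unites a family on the left
  of \<open>b\<close> with one on the right, and takes the two suprema one after the other.\<close>

lemma variation_add:
  assumes g: "small_variation g" and "a \<le> b" "b \<le> c"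
  shows "variation g a c = variation g a b + variation g b c"
proof (rule antisym)
  show "variation g a c \<le> variation g a b + variation g b c"
  proof (rule variation_least)
    fix D assume D: "D \<in> families a c"
    obtain D1 D2 where "D1 \<in> families a b" "D2 \<in> families b c" "var_sum g D \<le> var_sum g D1 + var_sum g D2"
      using families_split[OF D] assms by metis
    then show "var_sum g D \<le> variation g a b + variation g b c"
      using variation_upper[OF g] by (meson add_mono order_trans)
  qed
  have *: "var_sum g D1 + var_sum g D2 \<le> variation g a c" if D: "D1 \<in> families a b" "D2 \<in> families b c" for D1 D2
  proof -
    note 1 = familiesD[OF D(1)] and 2 = familiesD[OF D(2)]
    have sep: "{fst d<..<snd d} \<inter> {fst d'<..<snd d'} = {}" if "d \<in> D1" "d' \<in> D2" for d d'
      using 1(4)[of "fst d" "snd d"] 2(3)[of "fst d'" "snd d'"] that by auto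
    have "D1 \<union> D2 \<in> families a c"
    proof (rule familiesI)
      show "finite (D1 \<union> D2)" using 1(1) 2(1) by simp
      show "s < t \<and> a \<le> s \<and> t \<le> c" if "(s, t) \<in> D1 \<union> D2" for s t
        using that 1(2-4)[of s t] 2(2-4)[of s t] \<open>a \<le> b\<close> \<open>b \<le> c\<close> by fastforce
      show "{fst d<..<snd d} \<inter> {fst d'<..<snd d'} = {}" if "d \<in> D1 \<union> D2" "d' \<in> D1 \<union> D2" "d \<noteq> d'" for d d'
        using that sep familiesD_disjoint[OF D(1)] familiesD_disjoint[OF D(2)] by blast
    qed
    moreover have "D1 \<inter> D2 = {}"
      using 1(2,4) 2(3) by fastforce
    then have "var_sum g (D1 \<union> D2) = var_sum g D1 + var_sum g D2"
      unfolding var_sum_def using 1(1) 2(1) by (intro sum.union_disjoint)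
    ultimately show ?thesis using variation_upper[OF g] by metis
  qed
  have "variation g a b \<le> variation g a c - var_sum g D2" if "D2 \<in> families b c" for D2
    using *[OF _ that] by (intro variation_least) (simp add: le_diff_eq)
  then have "variation g b c \<le> variation g a c - variation g a b"
    by (intro variation_least) (simp add: le_diff_eq add.commute)
  then show "variation g a b + variation g b c \<le> variation g a c" by simp
qed

lemma singleton_in_families: "a < b \<Longrightarrow> {(a, b)} \<in> families a b"
  by (rule familiesI) auto

lemma abs_diff_le_variation:
  assumes "small_variation g" "a \<le> b"
  shows "\<bar>g b - g a\<bar> \<le> variation g a b"
proof (cases "a = b")
  case True
  then show ?thesis using variation_nonneg[OF assms(1)] by simp
next
  case False
  then show ?thesis using variation_upper[OF assms(1) singleton_in_families[of a b]] assms(2)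
    by (simp add: var_sum_def)
qed

text \<open>In each interval of \<open>D\<close> a nearly optimal family is chosen. Their union is
  no longer in total than \<open>D\<close>, so the smallness condition for \<open>g\<close> applies
  to it and bounds the variations up to the approximation errors.\<close>

lemma small_variation_variation:
  assumes g: "small_variation g" and "\<epsilon> > 0"
  shows "\<exists>\<delta>>0. \<forall>D\<in>families a b. var_sum id D < \<delta> \<longrightarrow> (\<Sum>d\<in>D. variation g (fst d) (snd d)) < \<epsilon>"
proof -
  obtain \<delta> where \<delta>: "\<delta> > 0" "\<And>D. D \<in> families a b \<Longrightarrow> var_sum id D < \<delta> \<Longrightarrow> var_sum g D < \<epsilon> / 3"
    using g \<open>\<epsilon> > 0\<close> unfolding small_variation_def by (metis divide_pos_pos zero_less_numeral)
  have "(\<Sum>d\<in>D. variation g (fst d) (snd d)) < \<epsilon>" if D: "D \<in> families a b" and len: "var_sum id D < \<delta>" for D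
  proof -
    \<comment> \<open>Chosen so that \<open>card D\<close> errors add up to at most a third of
      \<open>\<epsilon>\<close>; the summand 1 keeps the denominator positive for empty
      \<open>D\<close>.\<close>
    define \<eta> where "\<eta> = \<epsilon> / 3 / (real (card D) + 1)"
    have "\<eta> > 0" using \<open>\<epsilon> > 0\<close> by (simp add: \<eta>_def)
    have "\<exists>E\<in>families s t. variation g s t < var_sum g E + \<eta>" for s t
    proof (rule ccontr)
      assume "\<not> ?thesis"
      then have "variation g s t \<le> variation g s t - \<eta>"
        by (intro variation_least) (auto simp: not_less le_diff_eq)
      then show False using \<open>\<eta> > 0\<close> by simp
    qed
    then obtain E where E: "\<And>s t. E s t \<in> families s t" "\<And>s t. variation g s t < var_sum g (E s t) + \<eta>"
      by metis
    let ?U = "\<Union>d\<in>D. E (fst d) (snd d)"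
    have U: "?U \<in> families a b" "\<And>g. var_sum g ?U = (\<Sum>d\<in>D. var_sum g (E (fst d) (snd d)))"
      using families_join[OF D, of "\<lambda>d. E (fst d) (snd d)"] E(1) by auto
    have "var_sum id ?U \<le> var_sum id D"
      unfolding U(2) unfolding var_sum_def[of id D]
    proof (rule sum_mono)
      fix d assume "d \<in> D"
      then have "fst d < snd d" using familiesD(2)[OF D] by (metis prod.collapse)
      then show "var_sum id (E (fst d) (snd d)) \<le> (case d of (s, t) \<Rightarrow> \<bar>id t - id s\<bar>)"
        using var_sum_id_le[OF E(1)[of "fst d" "snd d"]] by (simp add: split_beta)
    qed
    then have "var_sum g ?U < \<epsilon> / 3" using \<delta>(2)[OF U(1)] len by simp
    moreover have "(\<Sum>d\<in>D. variation g (fst d) (snd d)) \<le> (\<Sum>d\<in>D. var_sum g (E (fst d) (snd d)) + \<eta>)"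
      using E(2) by (intro sum_mono less_imp_le)
    then have "(\<Sum>d\<in>D. variation g (fst d) (snd d)) \<le> var_sum g ?U + real (card D) * \<eta>"
      unfolding U(2) sum.distrib by simp
    moreover have "real (card D) * \<eta> \<le> \<epsilon> / 3"
      using \<open>\<epsilon> > 0\<close> unfolding \<eta>_def by (simp add: field_simps)
    ultimately show ?thesis using \<open>\<epsilon> > 0\<close> by simp
  qed
  then show ?thesis using \<open>\<delta> > 0\<close> by blast
qed

text \<open>\<open>F\<close> is the variation counted from 0 with sign, so its increments are
  variations. They dominate the increments of \<open>g\<close>, hence \<open>F - g\<close> is
  nondecreasing too, and its sums are bounded by those of \<open>F\<close> and \<open>g\<close>
  together.\<close>

lemma small_variation_eq_diff_mono:
  assumes g: "small_variation g"
  obtains F G where "mono F" "mono G" "small_variation F" "small_variation G" "\<And>x. g x = F x - G x"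
proof -
  define F where "F x = (if 0 \<le> x then variation g 0 x else - variation g x 0)" for x
  \<comment> \<open>The three instances of additivity treat 0 between, before and after the two
    points.\<close>
  have F: "F y - F x = variation g x y" if "x \<le> y" for x y
    using variation_add[OF g, of x 0 y] variation_add[OF g, of 0 x y] variation_add[OF g, of x y 0] that
    by (auto simp: F_def)
  have F_small: "small_variation F"
    unfolding small_variation_def
  proof (intro allI impI)
    fix a b \<epsilon> :: real assume "0 < \<epsilon>"
    have "var_sum F D = (\<Sum>d\<in>D. variation g (fst d) (snd d))" if "D \<in> families a b" for D
      unfolding var_sum_def using familiesD(2)[OF that] variation_nonneg[OF g]
      by (intro sum.cong) (auto simp: split_beta F less_imp_le)
    then show "\<exists>\<delta>>0. \<forall>D\<in>families a b. var_sum id D < \<delta> \<longrightarrow> var_sum F D < \<epsilon>"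
      using small_variation_variation[OF g \<open>0 < \<epsilon>\<close>, of a b] by simp
  qed
  show ?thesis
  proof (rule that[of F "\<lambda>x. F x - g x"])
    show "mono F" using F variation_nonneg[OF g] by (intro monoI) (metis diff_ge_0_iff_ge)
    show "mono (\<lambda>x. F x - g x)"
      using F abs_diff_le_variation[OF g] by (intro monoI) (smt (verit))
    show "small_variation F" by (rule F_small)
    show "small_variation (\<lambda>x. F x - g x)"
      unfolding small_variation_def
    proof (intro allI impI)
      fix a b \<epsilon> :: real assume "0 < \<epsilon>"
      obtain \<delta>1 where 1: "\<delta>1 > 0" "\<And>D. D \<in> families a b \<Longrightarrow> var_sum id D < \<delta>1 \<Longrightarrow> var_sum g D < \<epsilon> / 2"
        using g \<open>0 < \<epsilon>\<close> unfolding small_variation_def by (metis half_gt_zero)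
      obtain \<delta>2 where 2: "\<delta>2 > 0" "\<And>D. D \<in> families a b \<Longrightarrow> var_sum id D < \<delta>2 \<Longrightarrow> var_sum F D < \<epsilon> / 2"
        using F_small \<open>0 < \<epsilon>\<close> unfolding small_variation_def by (metis half_gt_zero)
      have "var_sum (\<lambda>x. F x - g x) D \<le> var_sum F D + var_sum g D" for D
        unfolding var_sum_def sum.distrib[symmetric] by (intro sum_mono) auto
      then show "\<exists>\<delta>>0. \<forall>D\<in>families a b. var_sum id D < \<delta> \<longrightarrow> var_sum (\<lambda>x. F x - g x) D < \<epsilon>"
        using 1 2 by (intro exI[of _ "min \<delta>1 \<delta>2"]) (fastforce intro: order_le_less_trans)
    qed
  qed simp
qed

section \<open>Lebesgue differentiation\<close>

text \<open>Returns to sequences, with degenerate intervals allowed, since open sets will be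
  decomposed into sequences of intervals. The index set \<open>I\<close> drops the degenerate ones,
  which contribute nothing to either sum.\<close>

lemma small_variation_sequence:
  assumes g: "small_variation g" and "\<epsilon> > 0"
  obtains \<delta> where "\<delta> > 0"
    "\<And>(k::nat) s t. (\<And>n. a \<le> s n \<and> s n \<le> t n \<and> t n \<le> b) \<Longrightarrow>
      disjoint_family (\<lambda>n. {s n<..<t n}) \<Longrightarrow> (\<Sum>n<k. t n - s n) < \<delta> \<Longrightarrow>
      (\<Sum>n<k. \<bar>g (t n) - g (s n)\<bar>) < \<epsilon>"
proof -
  obtain \<delta> where \<delta>: "\<delta> > 0" "\<And>D. D \<in> families a b \<Longrightarrow> var_sum id D < \<delta> \<Longrightarrow> var_sum g D < \<epsilon>"
    using g \<open>\<epsilon> > 0\<close> unfolding small_variation_def by metis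
  show ?thesis
  proof (rule that[OF \<delta>(1)])
    fix k :: nat and s t :: "nat \<Rightarrow> real"
    assume st: "\<And>n. a \<le> s n \<and> s n \<le> t n \<and> t n \<le> b"
      and disj: "disjoint_family (\<lambda>n. {s n<..<t n})" and len: "(\<Sum>n<k. t n - s n) < \<delta>"
    define I where "I = {n. n < k \<and> s n < t n}"
    have disj': "{s i<..<t i} \<inter> {s j<..<t j} = {}" if "i \<noteq> j" for i j
      using disj that by (auto simp: disjoint_family_on_def)
    have inj: "inj_on (\<lambda>n. (s n, t n)) I"
    proof (rule inj_onI, rule ccontr)
      fix i j assume "i \<in> I" "(s i, t i) = (s j, t j)" "i \<noteq> j"
      with disj'[of i j] show False by (auto simp: I_def)
    qed
    have sum: "(\<Sum>n<k. \<bar>q (t n) - q (s n)\<bar>) = var_sum q ((\<lambda>n. (s n, t n)) ` I)" for q :: "real \<Rightarrow> real"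
    proof -
      have "(\<Sum>n<k. \<bar>q (t n) - q (s n)\<bar>) = (\<Sum>n\<in>I. \<bar>q (t n) - q (s n)\<bar>)"
      proof (rule sum.mono_neutral_right)
        show "\<forall>i\<in>{..<k} - I. \<bar>q (t i) - q (s i)\<bar> = 0"
        proof
          fix i assume "i \<in> {..<k} - I"
          then have "t i = s i" using st[of i] by (auto simp: I_def)
          then show "\<bar>q (t i) - q (s i)\<bar> = 0" by simp
        qed
      qed (auto simp: I_def)
      then show ?thesis unfolding var_sum_def by (subst sum.reindex[OF inj]) simp
    qed
    have "(\<lambda>n. (s n, t n)) ` I \<in> families a b"
    proof (rule familiesI)
      show "finite ((\<lambda>n. (s n, t n)) ` I)" by (auto simp: I_def)
      show "x < y \<and> a \<le> x \<and> y \<le> b" if "(x, y) \<in> (\<lambda>n. (s n, t n)) ` I" for x y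
        using that st by (auto simp: I_def)
      show "{fst d<..<snd d} \<inter> {fst d'<..<snd d'} = {}"
        if dd: "d \<in> (\<lambda>n. (s n, t n)) ` I" "d' \<in> (\<lambda>n. (s n, t n)) ` I" "d \<noteq> d'" for d d'
      proof -
        obtain i j where "d = (s i, t i)" "d' = (s j, t j)" using dd by auto
        then show ?thesis using disj'[of i j] dd(3) by fastforce
      qed
    qed
    moreover have "(\<Sum>n<k. \<bar>id (t n) - id (s n)\<bar>) = (\<Sum>n<k. t n - s n)"
      by (rule sum.cong) (use st in auto)
    with len have "var_sum id ((\<lambda>n. (s n, t n)) ` I) < \<delta>"
      unfolding sum by simp
    ultimately show "(\<Sum>n<k. \<bar>g (t n) - g (s n)\<bar>) < \<epsilon>"
      unfolding sum by (rule \<delta>(2))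
  qed
qed

section \<open>Open sets as disjoint unions of intervals\<close>

text \<open>Openness keeps \<open>Inf C\<close> and \<open>Sup C\<close> out of \<open>C\<close>;
  connectedness fills everything between them.\<close>

lemma open_connected_bounded_real:
  fixes C :: "real set"
  assumes "open C" "connected C" "C \<noteq> {}" "C \<subseteq> {a..b}"
  obtains s t where "C = {s<..<t}" "a \<le> s" "s < t" "t \<le> b"
proof -
  have bdd: "bdd_below C" "bdd_above C" using bdd_below_mono[OF bdd_below_Icc assms(4)] bdd_above_mono[OF bdd_above_Icc assms(4)] by blast+
  have "Inf C < x \<and> x < Sup C" if x: "x \<in> C" for x
  proof -
    obtain e where e: "e > 0" "cball x e \<subseteq> C"
      using \<open>open C\<close> x open_contains_cball by metis
    then have "x - e \<in> C" "x + e \<in> C" by (auto simp: dist_real_def)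
    then show ?thesis using cInf_lower[OF _ bdd(1)] cSup_upper[OF _ bdd(2)] \<open>e > 0\<close> by force
  qed
  moreover have "x \<in> C" if x: "Inf C < x" "x < Sup C" for x
  proof -
    obtain y z where "y \<in> C" "y < x" "z \<in> C" "x < z"
      using x cInf_lessD[OF assms(3)] less_cSupD[OF assms(3)] by metis
    then show ?thesis using connected_contains_Icc[OF assms(2), of y z] by auto
  qed
  ultimately have C: "C = {Inf C<..<Sup C}" by auto
  moreover have "a \<le> Inf C" "Sup C \<le> b"
    using assms(3,4) by (auto intro!: cInf_greatest cSup_least)
  ultimately show ?thesis using assms(3) that by (metis greaterThanLessThan_empty_iff linorder_not_less)
qed

text \<open>The connected components of \<open>U\<close> are open, pairwise disjoint and countably
  many, and each of them is a bounded open interval.\<close>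

lemma open_real_disjoint_intervals:
  fixes U :: "real set"
  assumes "a \<le> b" "open U" "U \<subseteq> {a..b}"
  shows "\<exists>s t :: nat \<Rightarrow> real. U = (\<Union>n. {s n<..<t n}) \<and> disjoint_family (\<lambda>n. {s n<..<t n}) \<and>
    (\<forall>n. a \<le> s n \<and> s n \<le> t n \<and> t n \<le> b)"
proof -
  have cnt: "countable (components U)"
    using \<open>open U\<close> by (intro countable_disjoint_open_subsets)
      (auto intro: open_components simp: disjoint_def dest: components_eq)
  \<comment> \<open>Indices that number no component receive the empty set, later written as
    \<open>{a<..<a}\<close>. This keeps the sequence disjoint even when there are only finitely many
    components.\<close>
  define A where "A n = (if n \<in> to_nat_on (components U) ` components U then from_nat_into (components U) n else {})" for n
  have A: "A n \<in> components U \<or> A n = {}" for n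
    using cnt by (auto simp: A_def)
  have "\<exists>s t. A n = {s<..<t} \<and> a \<le> s \<and> s \<le> t \<and> t \<le> b" for n
  proof (cases "A n = {}")
    case True
    then show ?thesis using \<open>a \<le> b\<close> by (intro exI[of _ a]) auto
  next
    case False
    then have "A n \<in> components U" using A by auto
    then have "open (A n)" "connected (A n)" "A n \<subseteq> {a..b}"
      using assms open_components in_components_connected in_components_subset by blast+
    with False open_connected_bounded_real show ?thesis by (metis less_imp_le)
  qed
  then obtain s t where st: "\<And>n. A n = {s n<..<t n}" "\<And>n. a \<le> s n \<and> s n \<le> t n \<and> t n \<le> b"
    by metis
  have "disjoint_family A"
    unfolding disjoint_family_on_def
  proof (intro ballI impI)
    fix i j :: nat assume "i \<noteq> j"
    show "A i \<inter> A j = {}"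
    proof (rule ccontr)
      assume ne: "A i \<inter> A j \<noteq> {}"
      then have "A i \<in> components U" "A j \<in> components U" using A by blast+
      then have "A i = A j" using ne components_eq by blast
      moreover obtain C C' where "C \<in> components U" "C' \<in> components U" "i = to_nat_on (components U) C" "j = to_nat_on (components U) C'"
        using ne by (auto simp: A_def split: if_splits)
      ultimately show False using cnt \<open>i \<noteq> j\<close> by (auto simp: A_def)
    qed
  qed
  moreover have "U = (\<Union>n. A n)"
  proof
    show "(\<Union>n. A n) \<subseteq> U" using A in_components_subset by blast
    show "U \<subseteq> (\<Union>n. A n)"
    proof
      fix x assume "x \<in> U"
      then obtain C where C: "C \<in> components U" "x \<in> C" using Union_components[of U] by blast
      then have "A (to_nat_on (components U) C) = C" using cnt by (simp add: A_def)
      then show "x \<in> (\<Union>n. A n)" using C by blast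
    qed
  qed
  moreover have "A = (\<lambda>n. {s n<..<t n})" using st(1) by blast
  ultimately show ?thesis using st(2) by blast
qed

lemma small_variation_continuous:
  assumes g: "small_variation g"
  shows "continuous_on UNIV g"
  unfolding continuous_on_iff
proof (intro ballI allI impI)
  fix x e :: real assume "e > 0"
  then obtain \<delta> where \<delta>: "\<delta> > 0" "\<And>D. D \<in> families (x - 1) (x + 1) \<Longrightarrow> var_sum id D < \<delta> \<Longrightarrow> var_sum g D < e"
    using g unfolding small_variation_def by metis
  have small: "\<bar>g t - g s\<bar> < e" if st: "s \<in> {x - 1..x + 1}" "t \<in> {x - 1..x + 1}" "s < t" "t - s < \<delta>" for s t
    using \<delta>(2)[of "{(s, t)}"] families_mono[OF singleton_in_families[OF \<open>s < t\<close>], of "x - 1" "x + 1"] st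
    by (simp add: var_sum_def)
  show "\<exists>d>0. \<forall>y\<in>UNIV. dist y x < d \<longrightarrow> dist (g y) (g x) < e"
  proof (intro exI[of _ "min \<delta> 1"] conjI ballI impI)
    fix y assume y: "dist y x < min \<delta> 1"
    consider "y < x" | "y = x" | "y > x" by linarith
    then show "dist (g y) (g x) < e"
    proof cases
      case 1
      then show ?thesis using small[of y x] y by (auto simp: dist_real_def abs_if split: if_splits)
    next
      case 2
      then show ?thesis using \<open>e > 0\<close> by simp
    next
      case 3
      then show ?thesis using small[of x y] y by (auto simp: dist_real_def abs_if split: if_splits)
    qed
  qed (use \<open>\<delta> > 0\<close> in auto)
qed

section \<open>Stieltjes measures, densities and differentiation almost everywhere\<close>

text \<open>By outer regularity a bounded null set lies in an open set of length below
  \<open>\<delta>\<close>. That set is a disjoint union of intervals, finitely many of which always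
  have Stieltjes mass below \<open>\<epsilon>\<close>; countable additivity passes to the whole set.
  A general null set is exhausted by its bounded parts.\<close>

lemma interval_measure_small_variation_abs_cont:
  assumes F: "mono F" "small_variation F"
  shows "absolutely_continuous lborel (interval_measure F)"
proof -
  let ?\<mu> = "interval_measure F"
  have rc: "continuous (at_right x) F" for x
    using small_variation_continuous[OF F(2)] by (simp add: continuous_on_eq_continuous_within continuous_at_imp_continuous_at_within)
  have mF: "x \<le> y \<Longrightarrow> F x \<le> F y" for x y using F(1) by (rule monoD)
  have null: "emeasure ?\<mu> B = 0" if B: "B \<in> null_sets lborel" "B \<subseteq> {- real n<..<real n}" for B n
  proof -
    have "emeasure ?\<mu> B \<le> 0"
    proof (rule ennreal_le_epsilon)
      fix \<epsilon> :: real assume "\<epsilon> > 0"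
      obtain \<delta> where \<delta>: "\<delta> > 0" "\<And>(k::nat) s t. (\<And>i. - real n \<le> s i \<and> s i \<le> t i \<and> t i \<le> real n) \<Longrightarrow>
        disjoint_family (\<lambda>i. {s i<..<t i}) \<Longrightarrow> (\<Sum>i<k. t i - s i) < \<delta> \<Longrightarrow> (\<Sum>i<k. \<bar>F (t i) - F (s i)\<bar>) < \<epsilon>"
        by (rule small_variation_sequence[OF F(2) \<open>\<epsilon> > 0\<close>, of "- real n" "real n"]) (rule that, assumption, blast)
      obtain V where V: "open V" "B \<subseteq> V" "emeasure lborel (V - B) < \<delta>"
        using outer_regular_lborel[of B \<delta>] B \<delta>(1) by (auto simp: null_sets_def)
      \<comment> \<open>The intersection places all intervals inside the range for which
        \<open>\<delta>\<close> was chosen.\<close>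
      define U where "U = V \<inter> {- real n<..<real n}"
      have U: "open U" "B \<subseteq> U" "U \<subseteq> {- real n..real n}" using V B by (auto simp: U_def)
      have "emeasure lborel U \<le> emeasure lborel ((V - B) \<union> B)"
        using U V B by (intro emeasure_mono) (auto simp: U_def)
      also have "\<dots> = emeasure lborel (V - B)"
        using V(1) B(1) by (intro emeasure_Un_null_set) auto
      finally have lU: "emeasure lborel U < \<delta>" using V(3) by simp
      obtain s t :: "nat \<Rightarrow> real" where st: "U = (\<Union>i. {s i<..<t i})" "disjoint_family (\<lambda>i. {s i<..<t i})"
        "\<And>i. - real n \<le> s i \<and> s i \<le> t i \<and> t i \<le> real n"
        using open_real_disjoint_intervals[OF _ U(1,3)] by force
      have part: "(\<Sum>i<k. emeasure ?\<mu> {s i<..<t i}) \<le> ennreal \<epsilon>" for k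
      proof -
        have "ennreal (\<Sum>i<k. t i - s i) = (\<Sum>i<k. emeasure lborel {s i<..<t i})"
          using st(3) by (subst sum_ennreal[symmetric]) auto
        also have "\<dots> = emeasure lborel (\<Union>i<k. {s i<..<t i})"
          using st(2) by (intro sum_emeasure) (auto simp: disjoint_family_on_def)
        also have "\<dots> \<le> emeasure lborel U"
          using U(1) by (intro emeasure_mono) (auto simp: st(1))
        finally have "ennreal (\<Sum>i<k. t i - s i) < ennreal \<delta>"
          using lU by (rule order_le_less_trans)
        moreover have "0 \<le> (\<Sum>i<k. t i - s i)"
          by (rule sum_nonneg) (use st(3) in simp)
        ultimately have "(\<Sum>i<k. t i - s i) < \<delta>" by (simp add: ennreal_less_iff)
        then have *: "(\<Sum>i<k. \<bar>F (t i) - F (s i)\<bar>) < \<epsilon>"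
          using st by (intro \<delta>(2)) auto
        have "(\<Sum>i<k. emeasure ?\<mu> {s i<..<t i}) \<le> (\<Sum>i<k. emeasure ?\<mu> {s i<..t i})"
          by (intro sum_mono emeasure_mono) auto
        also have "\<dots> = ennreal (\<Sum>i<k. \<bar>F (t i) - F (s i)\<bar>)"
          using st(3) mF by (subst sum_ennreal[symmetric]) (auto simp: emeasure_interval_measure_Ioc[OF _ mF rc])
        also have "\<dots> \<le> ennreal \<epsilon>" using * by (simp add: ennreal_leI)
        finally show ?thesis .
      qed
      have "emeasure ?\<mu> B \<le> emeasure ?\<mu> U"
        using U by (intro emeasure_mono) auto
      also have "\<dots> = (\<Sum>i. emeasure ?\<mu> {s i<..<t i})"
        unfolding st(1) using st(2) by (intro suminf_emeasure[symmetric]) auto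
      also have "\<dots> \<le> ennreal \<epsilon>"
        using part by (intro suminf_le_const) auto
      finally show "emeasure ?\<mu> B \<le> 0 + ennreal \<epsilon>" by simp
    qed
    then show ?thesis by simp
  qed
  show ?thesis
    unfolding absolutely_continuous_def
  proof
    fix N assume N: "N \<in> null_sets (lborel :: real measure)"
    have "N \<inter> {- real n<..<real n} \<in> null_sets ?\<mu>" for n :: nat
      using null[of "N \<inter> {- real n<..<real n}" n] N
      by (auto simp: null_sets_def intro!: null_sets.Int) (metis Int_lower1 emeasure_eq_0 null_setsD2 N sets_lborel)
    then have "(\<Union>n. N \<inter> {- real n<..<real n}) \<in> null_sets ?\<mu>" by (rule null_sets_UN)
    moreover have "(\<Union>n. N \<inter> {- real n<..<real n}) = N"
    proof
      show "N \<subseteq> (\<Union>n. N \<inter> {- real n<..<real n})"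
      proof
        fix x assume "x \<in> N"
        moreover obtain n :: nat where "\<bar>x\<bar> < real n" using reals_Archimedean2 by blast
        then have "x \<in> {- real n<..<real n}" by (simp add: abs_less_iff)
        ultimately show "x \<in> (\<Union>n. N \<inter> {- real n<..<real n})" by auto
      qed
    qed auto
    ultimately show "N \<in> null_sets ?\<mu>" by simp
  qed
qed

text \<open>The Radon-Nikodym derivative of the Stieltjes measure, evaluated on closed intervals;
  continuity of \<open>F\<close> rules out atoms at their endpoints.\<close>

lemma mono_small_variation_density:
  assumes F: "mono F" "small_variation F"
  obtains f :: "real \<Rightarrow> real" where "f \<in> borel_measurable borel"
    "\<And>a b. a \<le> b \<Longrightarrow> set_integrable lborel {a..b} f"
    "\<And>a b. a \<le> b \<Longrightarrow> F b - F a = (LBINT x:{a..b}. f x)"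
proof -
  let ?\<mu> = "interval_measure F"
  have cont: "continuous_on UNIV F" by (rule small_variation_continuous[OF F(2)])
  then have rc: "continuous (at_right x) F" for x
    by (simp add: continuous_on_eq_continuous_within continuous_at_imp_continuous_at_within)
  have mF: "x \<le> y \<Longrightarrow> F x \<le> F y" for x y using F(1) by (rule monoD)
  obtain d where d: "d \<in> borel_measurable lborel" "density lborel d = ?\<mu>"
    using sigma_finite_measure.Radon_Nikodym[OF lborel.sigma_finite_measure_axioms interval_measure_small_variation_abs_cont[OF F]] by auto
  \<comment> \<open>Sigma-finiteness forces \<open>d\<close> to be finite almost everywhere, so
    passing to \<open>enn2real\<close> does not change its integrals.\<close>
  have "sigma_finite_measure (density lborel d)"
    unfolding d(2) by (rule sigma_finite_interval_measure[OF mF rc])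
  then have fin: "AE x in lborel. d x \<noteq> \<infinity>"
    using sigma_finite_measure.sigma_finite_iff_density_finite[OF lborel.sigma_finite_measure_axioms d(1)] by simp
  have "integrable lborel (\<lambda>x. indicator {a..b} x * enn2real (d x)) \<and>
      (LINT x|lborel. indicator {a..b} x * enn2real (d x)) = F b - F a" if "a \<le> b" for a b
  proof (subst nn_integral_eq_integrable[symmetric])
    have "(\<integral>\<^sup>+x. ennreal (indicator {a..b} x * enn2real (d x)) \<partial>lborel) = (\<integral>\<^sup>+x. d x * indicator {a..b} x \<partial>lborel)"
      using fin by (intro nn_integral_cong_AE) (auto simp: indicator_def less_top elim!: eventually_mono)
    also have "\<dots> = emeasure ?\<mu> {a..b}"
      unfolding d(2)[symmetric] using d(1) by (subst emeasure_density) auto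
    also have "\<dots> = F b - F a"
      using that cont by (intro emeasure_interval_measure_Icc) (auto intro: mF)
    finally show "(\<integral>\<^sup>+x. ennreal (indicator {a..b} x * enn2real (d x)) \<partial>lborel) = ennreal (F b - F a)" .
  qed (use d(1) mF[OF that] in auto)
  then show ?thesis
    using d(1) that[of "\<lambda>x. enn2real (d x)"] by (simp add: set_integrable_def set_lebesgue_integral_def)
qed

text \<open>The density is the difference of the densities of the two monotone parts. At almost
  every point the averages of \<open>f\<close> over short intervals to the right converge to its
  value, which gives right difference quotients of \<open>g\<close>; left ones come from the
  reflected function.\<close>

theorem loc_abs_continuous_density:
  assumes "locally_abs_continuous_on UNIV g"
  obtains f :: "real \<Rightarrow> real" where "f \<in> borel_measurable borel"
    "\<And>a b. a \<le> b \<Longrightarrow> set_integrable lborel {a..b} f"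
    "\<And>a b. a \<le> b \<Longrightarrow> g b - g a = (LBINT x:{a..b}. f x)"
    "AE x in lborel. (g has_real_derivative f x) (at x)"
proof -
  obtain F G where FG: "mono F" "mono G" "small_variation F" "small_variation G" "\<And>x. g x = F x - G x"
    using small_variation_eq_diff_mono[OF loc_abs_continuous_imp_small_variation[OF assms]] by metis
  obtain f1 where f1: "f1 \<in> borel_measurable borel" "\<And>a b. a \<le> b \<Longrightarrow> set_integrable lborel {a..b} f1"
    "\<And>a b. a \<le> b \<Longrightarrow> F b - F a = (LBINT x:{a..b}. f1 x)"
    using mono_small_variation_density[OF FG(1,3)] by metis
  obtain f2 where f2: "f2 \<in> borel_measurable borel" "\<And>a b. a \<le> b \<Longrightarrow> set_integrable lborel {a..b} f2"
    "\<And>a b. a \<le> b \<Longrightarrow> G b - G a = (LBINT x:{a..b}. f2 x)"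
    using mono_small_variation_density[OF FG(2,4)] by metis
  define f where "f = (\<lambda>x. f1 x - f2 x)"
  have f: "f \<in> borel_measurable borel" "\<And>a b. a \<le> b \<Longrightarrow> set_integrable lborel {a..b} f"
    "\<And>a b. a \<le> b \<Longrightarrow> g b - g a = (LBINT x:{a..b}. f x)"
    using f1 f2 by (auto simp: f_def FG(5) set_integral_diff algebra_simps)
  have int: "f integrable_on {a..b}" "integral {a..b} f = g b - g a" if "a \<le> b" for a b
    using set_borel_integral_eq_integral[OF f(2)[OF that]] f(3)[OF that] by auto
  have int': "f integrable_on cbox a b" for a b
    using int(1)[of a b] by (cases "a \<le> b") auto
  \<comment> \<open>Averages of the reflected function to the right of \<open>- x\<close> are
    averages of \<open>f\<close> to the left of \<open>x\<close>.\<close>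
  have "(\<lambda>x. f (- x)) integrable_on cbox a b" for a b
    using int'[of "-b" "-a"] Henstock_Kurzweil_Integration.integrable_reflect_real[where f=f and a="-b" and b="-a"]
    unfolding minus_minus box_real by blast
  then obtain N2 where N2: "negligible N2" "\<And>x e. x \<notin> N2 \<Longrightarrow> 0 < e \<Longrightarrow>
     \<exists>d>0. \<forall>h. 0 < h \<and> h < d \<longrightarrow> norm (integral (cbox x (x + h *\<^sub>R One)) (\<lambda>x. f (- x)) /\<^sub>R h ^ DIM(real) - f (- x)) < e"
    using integrable_ccontinuous_explicit by blast
  obtain N1 where N1: "negligible N1" "\<And>x e. x \<notin> N1 \<Longrightarrow> 0 < e \<Longrightarrow>
     \<exists>d>0. \<forall>h. 0 < h \<and> h < d \<longrightarrow> norm (integral (cbox x (x + h *\<^sub>R One)) f /\<^sub>R h ^ DIM(real) - f x) < e"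
    using integrable_ccontinuous_explicit[OF int'] by blast
  have deriv: "(g has_real_derivative f x) (at x)" if x: "x \<notin> N1 \<union> uminus ` N2" for x
    unfolding DERIV_def
  proof (rule LIM_I)
    fix e :: real assume "0 < e"
    obtain d1 where d1: "d1 > 0" "\<And>h. 0 < h \<Longrightarrow> h < d1 \<Longrightarrow> \<bar>(g (x + h) - g x) / h - f x\<bar> < e"
      using N1(2)[of x e] x \<open>0 < e\<close> by (auto simp: int divide_inverse mult.commute)
    have "- x \<notin> N2" using x by force
    then obtain d2 where d2: "d2 > 0" "\<And>h. 0 < h \<Longrightarrow> h < d2 \<Longrightarrow>
        \<bar>integral {- x..- x + h} (\<lambda>x. f (- x)) / h - f x\<bar> < e"
      using N2(2)[of "- x" e] \<open>0 < e\<close> by (auto simp: divide_inverse mult.commute)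
    have refl: "integral {- x..- x + h} (\<lambda>x. f (- x)) = g x - g (x - h)" if "0 < h" for h
      using Henstock_Kurzweil_Integration.integral_reflect_real[where f=f and a="x - h" and b=x] int(2)[of "x - h" x] that
      by (simp add: algebra_simps)
    show "\<exists>s>0. \<forall>h. h \<noteq> 0 \<and> norm (h - 0) < s \<longrightarrow> norm ((g (x + h) - g x) / h - f x) < e"
    proof (intro exI[of _ "min d1 d2"] conjI allI impI)
      fix h :: real assume h: "h \<noteq> 0 \<and> norm (h - 0) < min d1 d2"
      show "norm ((g (x + h) - g x) / h - f x) < e"
      proof (cases "h > 0")
        case True
        then show ?thesis using d1(2)[of h] h by simp
      next
        case False
        then have "(g (x + h) - g x) / h = (g x - g (x - (- h))) / (- h)"
          using h by (simp add: field_simps)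
        then show ?thesis using d2(2)[of "- h"] refl[of "- h"] h False by simp
      qed
    qed (use d1(1) d2(1) in auto)
  qed
  have AE_neg: "AE x in lborel. x \<notin> N" if "negligible N" for N :: "real set"
  proof -
    have "AE x in lebesgue. x \<notin> N"
      using that by (intro AE_not_in) (simp add: negligible_iff_null_sets)
    then show ?thesis by (simp add: AE_completion_iff)
  qed
  \<comment> \<open>The exceptional set of the reflected function must itself be reflected, and
    Lebesgue measure is invariant under this.\<close>
  have "AE x in distr lborel borel uminus. x \<notin> N2"
    unfolding lborel_distr_uminus using AE_neg[OF N2(1)] .
  then have "AE x in lborel. - x \<notin> N2" by (rule AE_distrD[rotated]) simp
  with AE_neg[OF N1(1)] have "AE x in lborel. (g has_real_derivative f x) (at x)"
    by eventually_elim (rule deriv, auto)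
  with f that show ?thesis by metis
qed

section \<open>Integration by parts and differentiation of improper integrals\<close>

lemma loc_abs_continuous_imp_continuous:
  assumes "open S" "locally_abs_continuous_on S g"
  shows "continuous_on S g"
  unfolding continuous_on_eq_continuous_at[OF \<open>open S\<close>]
proof
  fix x assume "x \<in> S"
  obtain r where r: "r > 0" "cball x r \<subseteq> S"
    using \<open>open S\<close> \<open>x \<in> S\<close> open_contains_cball by metis
  then have ac: "abs_continuous_Icc (x - r) (x + r) g"
    using assms(2) by (auto simp: locally_abs_continuous_on_def cball_eq_atLeastAtMost)
  show "isCont g x"
    unfolding continuous_at_eps_delta
  proof (intro allI impI)
    fix e :: real assume "e > 0"
    then obtain \<delta> where \<delta>: "\<delta> > 0" "\<And>(n::nat) s t.
        (\<forall>k<n. x - r \<le> s k \<and> s k \<le> t k \<and> t k \<le> x + r) \<and>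
        disjoint_family_on (\<lambda>k. {s k<..<t k}) {..<n} \<and> (\<Sum>k<n. t k - s k) < \<delta> \<Longrightarrow>
        (\<Sum>k<n. \<bar>g (t k) - g (s k)\<bar>) < e"
      using ac unfolding abs_continuous_Icc_def by meson
    show "\<exists>d>0. \<forall>y. dist y x < d \<longrightarrow> dist (g y) (g x) < e"
    proof (intro exI[of _ "min \<delta> r"] conjI allI impI)
      fix y assume y: "dist y x < min \<delta> r"
      show "dist (g y) (g x) < e"
        using \<delta>(2)[of "Suc 0" "\<lambda>_. min x y" "\<lambda>_. max x y"] y
        by (cases "x \<le> y") (auto simp: disjoint_family_on_def dist_real_def abs_minus_commute)
    qed (use \<delta>(1) r(1) in auto)
  qed
qed

section \<open>Derivatives of improper integrals in their finite limit\<close>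

text \<open>Splitting at \<open>c\<close> leaves a constant improper integral and an integral over a
  compact interval on which \<open>\<phi>\<close> is continuous, where the fundamental theorem of
  calculus applies.\<close>

lemma has_real_derivative_lower_integral:
  fixes \<phi> :: "real \<Rightarrow> real"
  assumes int: "set_integrable lborel (einterval l (ereal b)) \<phi>"
    and cont: "continuous_on {c..b} \<phi>" and "l < ereal c" "c < x" "x < b"
  shows "((\<lambda>y. LBINT v:einterval l (ereal y). \<phi> v) has_real_derivative \<phi> x) (at x)"
proof -
  have "((\<lambda>y. LBINT v=c..y. \<phi> v) has_vector_derivative \<phi> x) (at x within {c..b})"
    using assms by (intro interval_integral_FTC2) auto
  then have "((\<lambda>y. LBINT v=c..y. \<phi> v) has_real_derivative \<phi> x) (at x)"
    using at_within_Icc_at[OF \<open>c < x\<close> \<open>x < b\<close>] by (simp add: has_real_derivative_iff_has_vector_derivative)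
  then have "((\<lambda>y. (LBINT v=l..c. \<phi> v) + (LBINT v=c..y. \<phi> v)) has_real_derivative \<phi> x) (at x)"
    using DERIV_add[OF DERIV_const] by fastforce
  then show ?thesis
  proof (rule has_field_derivative_transform_within_open[where S="{c<..<b}"])
    fix y assume y: "y \<in> {c<..<b}"
    then have ly: "l < ereal y" using \<open>l < ereal c\<close> by (auto intro: order.strict_trans)
    have "(LBINT v=l..c. \<phi> v) + (LBINT v=c..y. \<phi> v) = (LBINT v=l..y. \<phi> v)"
    proof (rule interval_integral_sum)
      have "min l (min (ereal c) (ereal y)) = l" "max l (max (ereal c) (ereal y)) = ereal y"
        using ly y \<open>l < ereal c\<close> by (auto simp: min_def max_def)
      moreover have "set_integrable lborel (einterval l (ereal y)) \<phi>"
        using int by (rule set_integrable_subset) (use y in \<open>auto simp: einterval_def\<close>)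
      ultimately show "interval_lebesgue_integrable lborel (min l (min (ereal c) (ereal y))) (max l (max (ereal c) (ereal y))) \<phi>"
        using ly by (simp add: interval_lebesgue_integrable_def less_imp_le)
    qed
    then show "(LBINT v=l..c. \<phi> v) + (LBINT v=c..y. \<phi> v) = (LBINT v:einterval l (ereal y). \<phi> v)"
      using ly by (simp add: interval_lebesgue_integral_def[of _ l "ereal y"] less_imp_le)
  qed (use assms in auto)
qed

lemma has_real_derivative_upper_integral:
  fixes \<phi> :: "real \<Rightarrow> real"
  assumes int: "set_integrable lborel (einterval (ereal c) u) \<phi>"
    and cont: "continuous_on {c..b} \<phi>" and "ereal b < u" "c < x" "x < b"
  shows "((\<lambda>y. LBINT v:einterval (ereal y) u. \<phi> v) has_real_derivative - \<phi> x) (at x)"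
proof -
  have "((\<lambda>y. LBINT v=c..y. \<phi> v) has_vector_derivative \<phi> x) (at x within {c..b})"
    using assms by (intro interval_integral_FTC2) auto
  then have "((\<lambda>y. LBINT v=c..y. \<phi> v) has_real_derivative \<phi> x) (at x)"
    using at_within_Icc_at[OF \<open>c < x\<close> \<open>x < b\<close>] by (simp add: has_real_derivative_iff_has_vector_derivative)
  then have "((\<lambda>y. (LBINT v=c..u. \<phi> v) - (LBINT v=c..y. \<phi> v)) has_real_derivative - \<phi> x) (at x)"
    using DERIV_diff[OF DERIV_const] by fastforce
  then show ?thesis
  proof (rule has_field_derivative_transform_within_open[where S="{c<..<b}"])
    fix y assume y: "y \<in> {c<..<b}"
    have "ereal y < ereal b" using y by simp
    then have yu: "ereal y < u" using \<open>ereal b < u\<close> by (rule order.strict_trans)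
    have cu: "ereal c < u" using yu y by (metis ereal_less_le greaterThanLessThan_iff less_ereal.simps(1) order.strict_trans)
    have "(LBINT v=c..y. \<phi> v) + (LBINT v=y..u. \<phi> v) = (LBINT v=c..u. \<phi> v)"
    proof (rule interval_integral_sum)
      have "min (ereal c) (min (ereal y) u) = ereal c" "max (ereal c) (max (ereal y) u) = u"
        using yu y cu by (auto simp: min_def max_def)
      then show "interval_lebesgue_integrable lborel (min (ereal c) (min (ereal y) u)) (max (ereal c) (max (ereal y) u)) \<phi>"
        using int cu by (simp add: interval_lebesgue_integrable_def less_imp_le)
    qed
    then show "(LBINT v=c..u. \<phi> v) - (LBINT v=c..y. \<phi> v) = (LBINT v:einterval (ereal y) u. \<phi> v)"
      using yu by (simp add: interval_lebesgue_integral_def[of _ "ereal y" u] less_imp_le)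
  qed (use assms in auto)
qed

section \<open>Fubini on a triangle and integration by parts\<close>

lemma set_integrable_enn2real:
  assumes [measurable]: "q \<in> borel_measurable M" "A \<in> sets M"
    and fin: "(\<integral>\<^sup>+t\<in>A. q t \<partial>M) < \<infinity>" "\<And>t. t \<in> A \<Longrightarrow> q t < \<infinity>"
  shows "set_integrable M A (\<lambda>t. enn2real (q t))"
    "(LINT t:A|M. enn2real (q t)) = enn2real (\<integral>\<^sup>+t\<in>A. q t \<partial>M)"
proof -
  have "(\<integral>\<^sup>+t. ennreal (indicator A t * enn2real (q t)) \<partial>M) = (\<integral>\<^sup>+t\<in>A. q t \<partial>M)"
    using fin(2) by (intro nn_integral_cong) (auto simp: indicator_def)
  also have "\<dots> = ennreal (enn2real (\<integral>\<^sup>+t\<in>A. q t \<partial>M))"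
    using fin(1) by simp
  finally have "integrable M (\<lambda>t. indicator A t * enn2real (q t)) \<and>
      (LINT t|M. indicator A t * enn2real (q t)) = enn2real (\<integral>\<^sup>+t\<in>A. q t \<partial>M)"
    by (subst (asm) nn_integral_eq_integrable) auto
  then show "set_integrable M A (\<lambda>t. enn2real (q t))"
    "(LINT t:A|M. enn2real (q t)) = enn2real (\<integral>\<^sup>+t\<in>A. q t \<partial>M)"
    by (simp_all add: set_integrable_def set_lebesgue_integral_def)
qed

text \<open>Fubini for \<open>q s * f t\<close> on the region of \<open>A \<times> A\<close> where
  \<open>R s t\<close> holds. With \<open>R\<close> the order relation this region is a triangle,
  \<open>Q\<close> collects \<open>q\<close> along one direction and \<open>H\<close> collects
  \<open>f\<close> along the other.\<close>

lemma set_integral_swap: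
  fixes q f Q H :: "real \<Rightarrow> real"
  assumes [measurable]: "q \<in> borel_measurable borel" "f \<in> borel_measurable borel" "A \<in> sets borel"
    "Measurable.pred (borel \<Otimes>\<^sub>M borel) (\<lambda>(t, s). R s t)"
    and q_nonneg: "\<And>s. 0 \<le> q s" and q_int: "set_integrable lborel A q"
    and Q: "\<And>t. t \<in> A \<Longrightarrow> Q t = (LBINT s:{s \<in> A. R s t}. q s)"
    and H: "\<And>s. s \<in> A \<Longrightarrow> H s = (LBINT t:{t \<in> A. R s t}. f t)"
    and int: "set_integrable lborel A (\<lambda>t. Q t * f t)"
  shows "set_integrable lborel A (\<lambda>s. q s * H s)"
    "(LBINT t:A. Q t * f t) = (LBINT s:A. q s * H s)"
proof -
  define T where "T s t \<longleftrightarrow> s \<in> A \<and> t \<in> A \<and> R s t" for s t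
  let ?\<Phi> = "\<lambda>t s. f t * (q s * of_bool (T s t))"
  have [measurable]: "Measurable.pred (borel \<Otimes>\<^sub>M borel) (\<lambda>(t, s). T s t)"
    unfolding T_def by measurable
  have q_T: "integrable lborel (\<lambda>s. q s * of_bool (T s t))" for t
  proof (rule Bochner_Integration.integrable_bound)
    show "integrable lborel (\<lambda>s. indicator A s * q s)" using q_int by (simp add: set_integrable_def)
    show "AE s in lborel. norm (q s * of_bool (T s t)) \<le> norm (indicator A s * q s)"
      by (auto simp: T_def)
  qed measurable
  have Q_T: "(LINT s|lborel. q s * of_bool (T s t)) = indicator A t * Q t" for t
    by (cases "t \<in> A") (auto simp: T_def Q set_lebesgue_integral_def indicator_def
      intro!: Bochner_Integration.integral_cong)
  have H_T: "q s * (LINT t|lborel. f t * of_bool (T s t)) = indicator A s * (q s * H s)" for s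
    by (cases "s \<in> A") (auto simp: T_def H set_lebesgue_integral_def indicator_def
      intro!: Bochner_Integration.integral_cong disjI2)
  have inner: "(LINT t|lborel. ?\<Phi> t s) = indicator A s * (q s * H s)" for s
    unfolding H_T[symmetric] by (subst integral_mult_right_zero[symmetric]) (simp add: mult_ac)
  have outer: "(LINT s|lborel. ?\<Phi> t s) = indicator A t * (Q t * f t)" for t
    using Q_T[of t] by (simp add: mult_ac)
  have int2: "integrable (lborel \<Otimes>\<^sub>M lborel) (case_prod ?\<Phi>)"
  proof (rule lborel_pair.Fubini_integrable)
    \<comment> \<open>As \<open>q\<close> is nonnegative, integrating absolute values over
      \<open>s\<close> gives exactly the absolute value of \<open>Q t * f t\<close>. Thus the
      one-dimensional hypothesis \<open>int\<close> already gives integrability on the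
      product.\<close>
    have "(LINT s|lborel. norm (?\<Phi> t s)) = \<bar>f t\<bar> * (LINT s|lborel. q s * of_bool (T s t))" for t
      using q_nonneg by (simp add: abs_mult)
    moreover have "0 \<le> (LINT s|lborel. q s * of_bool (T s t))" for t
      using q_nonneg by (simp add: integral_nonneg)
    ultimately have "(LINT s|lborel. norm (?\<Phi> t s)) = \<bar>indicator A t * (Q t * f t)\<bar>" for t
      unfolding outer[symmetric] by (simp add: abs_mult)
    then show "integrable lborel (\<lambda>t. LINT s|lborel. norm (case (t, s) of (t, s) \<Rightarrow> ?\<Phi> t s))"
      using integrable_abs[OF int[unfolded set_integrable_def]] by simp
    show "AE t in lborel. integrable lborel (\<lambda>s. case (t, s) of (t, s) \<Rightarrow> ?\<Phi> t s)"
      using q_T by simp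
  qed measurable
  show "set_integrable lborel A (\<lambda>s. q s * H s)"
    using lborel_pair.integrable_snd[OF int2] unfolding inner by (simp add: set_integrable_def)
  show "(LBINT t:A. Q t * f t) = (LBINT s:A. q s * H s)"
    using lborel_pair.Fubini_integral[OF int2] unfolding inner outer by (simp add: set_lebesgue_integral_def)
qed

text \<open>The density need not be the derivative of \<open>g\<close> at any given point.\<close>

definition is_density_of :: "(real \<Rightarrow> real) \<Rightarrow> (real \<Rightarrow> real) \<Rightarrow> bool" where
  "is_density_of f g \<longleftrightarrow> f \<in> borel_measurable borel \<and> continuous_on UNIV g \<and>
     (\<forall>a b. a \<le> b \<longrightarrow> set_integrable lborel {a..b} f \<and> g b - g a = (LBINT x:{a..b}. f x))"

lemma is_density_of_Ioo:
  assumes f: "is_density_of f g" and "a \<le> b"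
  shows "(LBINT x:{a<..<b}. f x) = g b - g a"
proof -
  have [measurable]: "f \<in> borel_measurable borel" using f by (simp add: is_density_of_def)
  have "AE t in lborel. t \<notin> {a, b}" by (rule AE_not_in) (auto intro: finite_imp_null_set_lborel)
  then have "AE x in lborel. x \<in> {a<..<b} \<longleftrightarrow> x \<in> {a..b}"
    by eventually_elim auto
  then have "(LBINT x:{a<..<b}. f x) = (LBINT x:{a..b}. f x)"
    by (intro set_integral_cong_set) (auto simp: set_borel_measurable_def)
  then show ?thesis using f \<open>a \<le> b\<close> by (auto simp: is_density_of_def)
qed

text \<open>On the triangle \<open>s < t\<close>, \<open>Q t\<close> is the integral of
  \<open>q\<close> up to \<open>t\<close> and \<open>g x - g s\<close> is the integral of
  \<open>f\<close> from \<open>s\<close> to \<open>x\<close>. Exchanging the integrals turns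
  \<open>Q * f\<close> into \<open>q s * (g x - g s)\<close>; removing the integrable part
  \<open>q s * g x\<close> leaves \<open>q * g\<close>.\<close>

lemma lower_integration_by_parts:
  fixes q :: "real \<Rightarrow> ennreal" and l :: ereal and x :: real
  defines "A \<equiv> einterval l (ereal x)" and "Q \<equiv> \<lambda>v. \<integral>\<^sup>+t\<in>einterval l (ereal v). q t \<partial>lborel"
  assumes q[measurable]: "q \<in> borel_measurable borel" and fin: "\<And>t. t \<in> A \<Longrightarrow> q t < \<infinity>" "Q x < \<infinity>"
    and f: "is_density_of f g"
    and int: "set_integrable lborel A (\<lambda>t. enn2real (Q t) * f t)"
  shows "set_integrable lborel A (\<lambda>t. enn2real (q t) * g t)"
    "(LBINT t:A. enn2real (Q t) * f t) = g x * enn2real (Q x) - (LBINT t:A. enn2real (q t) * g t)"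
proof -
  have [measurable]: "f \<in> borel_measurable borel" using f by (simp add: is_density_of_def)
  have [measurable]: "A \<in> sets borel" by (simp add: A_def)
  have qA: "set_integrable lborel A (\<lambda>t. enn2real (q t))" "(LBINT t:A. enn2real (q t)) = enn2real (Q x)"
    using set_integrable_enn2real[of q lborel A] fin by (auto simp: Q_def A_def)
  have swap: "set_integrable lborel A (\<lambda>s. enn2real (q s) * (g x - g s)) \<and>
    (LBINT t:A. enn2real (Q t) * f t) = (LBINT s:A. enn2real (q s) * (g x - g s))"
  proof -
    have 1: "enn2real (Q t) = (LBINT s:{s \<in> A. s < t}. enn2real (q s))" if "t \<in> A" for t
    proof -
      have A: "{s \<in> A. s < t} = einterval l (ereal t)"
        using that by (auto simp: A_def einterval_def)
      have "Q t \<le> Q x" unfolding Q_def using A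
        by (intro nn_integral_mono) (auto simp: A_def indicator_def)
      then have "Q t < \<infinity>" using fin(2) by (rule order_le_less_trans)
      then show ?thesis unfolding A Q_def
        using A fin(1) by (intro set_integrable_enn2real(2)[symmetric]) auto
    qed
    have 2: "g x - g s = (LBINT t:{t \<in> A. s < t}. f t)" if "s \<in> A" for s
    proof -
      have "{t \<in> A. s < t} = {s<..<x}"
        using that by (auto simp: A_def einterval_def intro: less_trans)
      then show ?thesis using is_density_of_Ioo[OF f, of s x] that by (simp add: A_def einterval_def)
    qed
    show ?thesis
      using set_integral_swap[where R="(<)" and q="\<lambda>t. enn2real (q t)" and f=f and A=A
        and Q="\<lambda>t. enn2real (Q t)" and H="\<lambda>s. g x - g s"] qA(1) int 1 2 by simp
  qed
  have gx: "set_integrable lborel A (\<lambda>s. enn2real (q s) * g x)"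
    using qA(1) by (intro set_integrable_mult_left) auto
  have "set_integrable lborel A (\<lambda>s. enn2real (q s) * g x - enn2real (q s) * (g x - g s))"
    using gx swap by (intro set_integral_diff) auto
  then show 1: "set_integrable lborel A (\<lambda>t. enn2real (q t) * g t)" by (simp add: algebra_simps)
  have "(LBINT t:A. enn2real (Q t) * f t) = (LBINT s:A. enn2real (q s) * g x - enn2real (q s) * g s)"
    using swap by (simp add: algebra_simps)
  also have "\<dots> = (LBINT s:A. enn2real (q s) * g x) - (LBINT s:A. enn2real (q s) * g s)"
    by (rule set_integral_diff(2)[OF gx 1])
  finally show "(LBINT t:A. enn2real (Q t) * f t) = g x * enn2real (Q x) - (LBINT t:A. enn2real (q t) * g t)"
    by (simp add: qA(2) mult.commute)
qed

text \<open>Mirror image on the triangle \<open>s > t\<close>, with \<open>g s - g x\<close> in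
  place of \<open>g x - g s\<close>; hence the opposite sign.\<close>

lemma upper_integration_by_parts:
  fixes q :: "real \<Rightarrow> ennreal" and u :: ereal and x :: real
  defines "A \<equiv> einterval (ereal x) u" and "Q \<equiv> \<lambda>v. \<integral>\<^sup>+t\<in>einterval (ereal v) u. q t \<partial>lborel"
  assumes q[measurable]: "q \<in> borel_measurable borel" and fin: "\<And>t. t \<in> A \<Longrightarrow> q t < \<infinity>" "Q x < \<infinity>"
    and f: "is_density_of f g"
    and int: "set_integrable lborel A (\<lambda>t. enn2real (Q t) * f t)"
  shows "set_integrable lborel A (\<lambda>t. enn2real (q t) * g t)"
    "(LBINT t:A. enn2real (Q t) * f t) = (LBINT t:A. enn2real (q t) * g t) - g x * enn2real (Q x)"
proof -
  have [measurable]: "f \<in> borel_measurable borel" using f by (simp add: is_density_of_def)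
  have [measurable]: "A \<in> sets borel" by (simp add: A_def)
  have qA: "set_integrable lborel A (\<lambda>t. enn2real (q t))" "(LBINT t:A. enn2real (q t)) = enn2real (Q x)"
    using set_integrable_enn2real[of q lborel A] fin by (auto simp: Q_def A_def)
  have swap: "set_integrable lborel A (\<lambda>s. enn2real (q s) * (g s - g x)) \<and>
    (LBINT t:A. enn2real (Q t) * f t) = (LBINT s:A. enn2real (q s) * (g s - g x))"
  proof -
    have 1: "enn2real (Q t) = (LBINT s:{s \<in> A. s > t}. enn2real (q s))" if "t \<in> A" for t
    proof -
      have A: "{s \<in> A. s > t} = einterval (ereal t) u"
        using that by (auto simp: A_def einterval_def)
      have "Q t \<le> Q x" unfolding Q_def using A
        by (intro nn_integral_mono) (auto simp: A_def indicator_def)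
      then have "Q t < \<infinity>" using fin(2) by (rule order_le_less_trans)
      then show ?thesis unfolding A Q_def
        using A fin(1) by (intro set_integrable_enn2real(2)[symmetric]) auto
    qed
    have 2: "g s - g x = (LBINT t:{t \<in> A. s > t}. f t)" if "s \<in> A" for s
    proof -
      have "ereal t < u" if "t < s" for t
        using that \<open>s \<in> A\<close> by (auto simp: A_def einterval_def intro: less_trans[of "ereal t" "ereal s" u])
      then have "{t \<in> A. s > t} = {x<..<s}"
        by (auto simp: A_def einterval_def)
      then show ?thesis using is_density_of_Ioo[OF f, of x s] that by (simp add: A_def einterval_def)
    qed
    show ?thesis
      using set_integral_swap[where R="(>)" and q="\<lambda>t. enn2real (q t)" and f=f and A=A
        and Q="\<lambda>t. enn2real (Q t)" and H="\<lambda>s. g s - g x"] qA(1) int 1 2 by simp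
  qed
  have gx: "set_integrable lborel A (\<lambda>s. enn2real (q s) * g x)"
    using qA(1) by (intro set_integrable_mult_left) auto
  have "set_integrable lborel A (\<lambda>s. enn2real (q s) * (g s - g x) + enn2real (q s) * g x)"
    using gx swap by (intro set_integral_add) auto
  then show 1: "set_integrable lborel A (\<lambda>t. enn2real (q t) * g t)" by (simp add: algebra_simps)
  have "(LBINT t:A. enn2real (Q t) * f t) = (LBINT s:A. enn2real (q s) * g s - enn2real (q s) * g x)"
    using swap by (simp add: algebra_simps)
  also have "\<dots> = (LBINT s:A. enn2real (q s) * g s) - (LBINT s:A. enn2real (q s) * g x)"
    by (rule set_integral_diff(2)[OF 1 gx])
  finally show "(LBINT t:A. enn2real (Q t) * f t) = (LBINT t:A. enn2real (q t) * g t) - g x * enn2real (Q x)"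
    by (simp add: qA(2) mult.commute)
qed

section \<open>Measurability of the iterated integrals and of the kernels\<close>

lemma lower_Ps_measurable [measurable]:
  assumes [measurable]: "p \<in> borel_measurable borel"
  shows "lower_Ps l p j \<in> borel_measurable borel"
proof (induction j)
  case (Suc j)
  note [measurable] = Suc
  have "(\<lambda>x. \<integral>\<^sup>+t\<in>{t. l < ereal t \<and> t < x}. lower_Ps l p j t \<partial>lborel) \<in> borel_measurable borel"
    by measurable
  then show ?case by (simp add: einterval_def)
qed simp

lemma upper_Ps_measurable [measurable]:
  assumes [measurable]: "p \<in> borel_measurable borel"
  shows "upper_Ps u p j \<in> borel_measurable borel"
proof (induction j)
  case (Suc j)
  note [measurable] = Suc
  have "(\<lambda>x. \<integral>\<^sup>+t\<in>{t. x < t \<and> ereal t < u}. upper_Ps u p j t \<partial>lborel) \<in> borel_measurable borel"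
    by measurable
  then show ?case by (simp add: einterval_def)
qed simp

lemma K_kernel_measurable [measurable]:
  assumes [measurable]: "p \<in> borel_measurable borel"
  shows "K_kernel l u p w i j x \<in> borel_measurable borel"
  unfolding K_kernel_def[abs_def] by measurable

section \<open>Expectations of kernels\<close>

lemma pieces_Suc: "pieces (Suc m) e = pieces m e \<union> einterval (e m) (e (Suc m))"
  by (auto simp: pieces_def atLeastAtMostSuc_conv)

lemma open_pieces: "open (pieces m e)"
  by (auto simp: pieces_def)

text \<open>Shows that the pieces miss only finitely many points. An infinite endpoint is sent to 0
  by \<open>real_of_ereal\<close>, which merely enlarges the finite exceptional set.\<close>

lemma einterval_subset_pieces:
  "einterval (e 0) (e m) \<subseteq> pieces m e \<union> (\<lambda>r. real_of_ereal (e r)) ` {..m}"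
proof (induction m)
  case 0
  then show ?case by (auto simp: einterval_def)
next
  case (Suc m)
  show ?case
  proof
    fix x assume x: "x \<in> einterval (e 0) (e (Suc m))"
    consider "ereal x < e m" | "ereal x = e m" | "e m < ereal x" by (metis linorder_neqE)
    then show "x \<in> pieces (Suc m) e \<union> (\<lambda>r. real_of_ereal (e r)) ` {..Suc m}"
    proof cases
      case 1
      then show ?thesis using x Suc by (fastforce simp: einterval_def pieces_Suc atMost_Suc)
    next
      case 2
      then have "x = real_of_ereal (e m)" by (metis real_of_ereal.simps(1))
      then show ?thesis by auto
    next
      case 3
      then show ?thesis using x by (simp add: einterval_def pieces_Suc)
    qed
  qed
qed

lemma pieces_subset_einterval:
  assumes "\<forall>r\<in>{1..m}. e (r - 1) < e r"
  shows "e 0 \<le> e m \<and> pieces m e \<subseteq> einterval (e 0) (e m)"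
  using assms
proof (induction m)
  case 0
  then show ?case by (simp add: pieces_def)
next
  case (Suc m)
  then have IH: "e 0 \<le> e m" "pieces m e \<subseteq> einterval (e 0) (e m)" by auto
  have lt: "e m < e (Suc m)" using Suc.prems by force
  have "pieces (Suc m) e \<subseteq> einterval (e 0) (e (Suc m))"
    using IH lt unfolding pieces_Suc einterval_def by (auto dest: order.strict_trans order_le_less_trans)
  then show ?case using IH(1) lt by (simp add: order_trans less_imp_le)
qed

lemma integrable_mult_right_cancel:
  fixes c :: real
  shows "integrable M (\<lambda>x. c * f x) \<longleftrightarrow> (c \<noteq> 0 \<longrightarrow> integrable M f)"
  by (cases "c = 0") auto

section \<open>Densities and \<open>deriv\<close>\<close>

lemma loc_abs_continuous_is_density:
  assumes "locally_abs_continuous_on UNIV g"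
  obtains f where "is_density_of f g" "AE x in lborel. deriv g x = f x"
proof -
  obtain f :: "real \<Rightarrow> real" where f: "f \<in> borel_measurable borel"
    "\<And>a b. a \<le> b \<Longrightarrow> set_integrable lborel {a..b} f"
    "\<And>a b. a \<le> b \<Longrightarrow> g b - g a = (LBINT x:{a..b}. f x)"
    "AE x in lborel. (g has_real_derivative f x) (at x)"
    using loc_abs_continuous_density[OF assms] by blast
  have "AE x in lborel. deriv g x = f x"
    using f(4) by eventually_elim (rule DERIV_imp_deriv)
  moreover have "is_density_of f g"
    using f(1-3) loc_abs_continuous_imp_continuous[OF open_UNIV assms] by (simp add: is_density_of_def)
  ultimately show ?thesis using that by blast
qed

text \<open>The density agrees with \<open>deriv g\<close> almost everywhere, so \<open>g\<close> is
  an integral of the continuous function \<open>deriv g\<close>. The fundamental theorem then makes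
  \<open>g\<close> differentiable at every point, where \<open>deriv\<close> alone might only be the
  default value.\<close>

lemma continuous_deriv_is_density:
  assumes g: "locally_abs_continuous_on UNIV g" and cont: "continuous_on UNIV (deriv g)"
  shows "is_density_of (deriv g) g" "(g has_real_derivative deriv g x) (at x)"
proof -
  obtain f where f: "is_density_of f g" and eq: "AE x in lborel. deriv g x = f x"
    using loc_abs_continuous_is_density[OF g] by blast
  have [measurable]: "f \<in> borel_measurable borel" using f by (simp add: is_density_of_def)
  have [measurable]: "deriv g \<in> borel_measurable borel"
    using cont by (rule borel_measurable_continuous_onI)
  have int: "set_integrable lborel {a..b} (deriv g)" for a b
    by (rule borel_integrable_atLeastAtMost') (rule continuous_on_subset[OF cont], simp)
  have diff: "g b - g a = (LBINT x:{a..b}. deriv g x)" if "a \<le> b" for a b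
  proof -
    have "(LBINT x:{a..b}. deriv g x) = (LBINT x:{a..b}. f x)"
      using eq by (intro set_lebesgue_integral_cong_AE) (auto elim!: eventually_mono)
    then show ?thesis using f that by (simp add: is_density_of_def)
  qed
  show "is_density_of (deriv g) g"
    using int diff cont loc_abs_continuous_imp_continuous[OF open_UNIV g] by (simp add: is_density_of_def)
  have "((\<lambda>y. LBINT v=x-1..y. deriv g v) has_vector_derivative deriv g x) (at x within {x-1..x+1})"
    by (rule interval_integral_FTC2) (auto intro: continuous_on_subset[OF cont])
  then have "((\<lambda>y. LBINT v=x-1..y. deriv g v) has_real_derivative deriv g x) (at x)"
    using at_within_Icc_at[of "x - 1" x "x + 1"] by (simp add: has_real_derivative_iff_has_vector_derivative)
  then have "((\<lambda>y. g (x-1) + (LBINT v=x-1..y. deriv g v)) has_real_derivative deriv g x) (at x)"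
    using DERIV_add[OF DERIV_const] by fastforce
  then show "(g has_real_derivative deriv g x) (at x)"
    by (rule has_field_derivative_transform_within_open[where S="{x-1<..<x+1}"])
      (auto simp: interval_integral_Icc diff[symmetric])
qed

section \<open>The fixed density, its tail integrals and their derivatives\<close>

locale stein_setting = prob_space M for M :: "'a measure" +
  fixes Z :: "'a \<Rightarrow> real" and p w :: "real \<Rightarrow> real" and m :: nat and e :: "nat \<Rightarrow> ereal" and l u :: ereal
  assumes p_nonneg: "\<And>x. 0 \<le> p x"
    and distr: "distributed M lborel Z (\<lambda>x. ennreal (p x))"
    and l_eq: "l = e 0" and u_eq: "u = e m"
    and e_less: "\<forall>r\<in>{1..m}. e (r - 1) < e r"
    and p_pos: "{x. p x > 0} = pieces m e"
    and p_loc_abs_cont: "\<forall>r\<in>{1..m}. locally_abs_continuous_on (einterval (e (r - 1)) (e r)) p"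
    and w_nonzero: "\<forall>x\<in>pieces m e. w x \<noteq> 0"
begin

abbreviation PL :: "nat \<Rightarrow> real \<Rightarrow> real" where "PL j v \<equiv> enn2real (lower_Ps l p j v)"
abbreviation PU :: "nat \<Rightarrow> real \<Rightarrow> real" where "PU j v \<equiv> enn2real (upper_Ps u p j v)"
abbreviation mL :: "nat \<Rightarrow> real \<Rightarrow> real" where "mL i \<equiv> (deriv ^^ i) (lower_m l p w)"
abbreviation mU :: "nat \<Rightarrow> real \<Rightarrow> real" where "mU i \<equiv> (deriv ^^ i) (upper_m u p w)"
abbreviation K :: "nat \<Rightarrow> nat \<Rightarrow> real \<Rightarrow> real \<Rightarrow> real" where "K \<equiv> K_kernel l u p w"

text \<open>The left tail integral, with \<open>U\<close> its right counterpart: every kernel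
  expectation becomes a combination of the two. As \<open>PL 0\<close> is \<open>p\<close>,
  \<open>L 0 g x\<close> is the integral of \<open>g * p\<close> up to \<open>x\<close>.\<close>

definition L :: "nat \<Rightarrow> (real \<Rightarrow> real) \<Rightarrow> real \<Rightarrow> real" where
  "L j g x = (LBINT v:einterval l (ereal x). PL j v * g v)"

definition U :: "nat \<Rightarrow> (real \<Rightarrow> real) \<Rightarrow> real \<Rightarrow> real" where
  "U j g x = (LBINT v:einterval (ereal x) u. PU j v * g v)"

lemma p_measurable [measurable]: "p \<in> borel_measurable borel"
  using distributed_real_measurable[OF _ distr] p_nonneg by simp

lemma Z_measurable [measurable]: "Z \<in> borel_measurable M"
  using distributed_measurable[OF distr] by simp

lemma P0 [simp]: "PL 0 v = p v" "PU 0 v = p v"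
  by (simp_all add: p_nonneg)

lemma in_pieces: "x \<in> pieces m e \<longleftrightarrow> 0 < p x"
  using p_pos by auto

lemma pieces_sub: "x \<in> pieces m e \<Longrightarrow> l < ereal x \<and> ereal x < u"
  using pieces_subset_einterval[OF e_less] by (auto simp: l_eq u_eq einterval_def)

text \<open>The exceptional points are \<open>x\<close> and finitely many interval endpoints.
  Excluding \<open>x\<close> makes the distinction between \<open>v \<le> x\<close> and
  \<open>v < x\<close> immaterial.\<close>

lemma AE_pieces: "AE v in lborel. v \<noteq> x \<and> (v \<in> pieces m e \<or> v \<notin> einterval l u)"
proof -
  have "AE v in lborel. v \<notin> insert x ((\<lambda>r. real_of_ereal (e r)) ` {..m})"
    by (rule AE_not_in) (auto intro: finite_imp_null_set_lborel)
  then show ?thesis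
    by eventually_elim (use einterval_subset_pieces[of e m] in \<open>auto simp: l_eq u_eq\<close>)
qed

lemma p_integrable: "integrable lborel p" "(LINT x|lborel. p x) = 1"
  using distributed_integrable[OF distr, of "\<lambda>_. 1"] distributed_integral[OF distr, of "\<lambda>_. 1"] p_nonneg
  by (simp_all add: prob_space)

lemma p_continuous: "continuous_on (pieces m e) p"
  unfolding continuous_on_eq_continuous_at[OF open_pieces]
proof
  fix x assume "x \<in> pieces m e"
  then obtain r where r: "r \<in> {1..m}" "x \<in> einterval (e (r - 1)) (e r)"
    by (auto simp: pieces_def)
  then have "continuous_on (einterval (e (r - 1)) (e r)) p"
    using p_loc_abs_cont by (intro loc_abs_continuous_imp_continuous) auto
  then show "isCont p x" using r(2) by (simp add: continuous_on_eq_continuous_at)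
qed

text \<open>At order 0 the value is a real number, at order 1 it is at most the total mass of
  \<open>p\<close>. From order 2 on, finiteness has to come from the kernel hypotheses.\<close>

lemma lower_Ps_finite: "j \<le> 1 \<Longrightarrow> lower_Ps l p j t < \<infinity>"
proof (cases j)
  case (Suc k)
  assume "j \<le> 1"
  then have "lower_Ps l p j t = (\<integral>\<^sup>+s\<in>einterval l (ereal t). ennreal (p s) \<partial>lborel)" using Suc by simp
  also have "\<dots> \<le> (\<integral>\<^sup>+s. ennreal (p s) \<partial>lborel)" by (intro nn_integral_mono) (auto simp: indicator_def)
  also have "\<dots> < \<infinity>" using p_integrable p_nonneg by (subst nn_integral_eq_integral) auto
  finally show ?thesis .
qed simp

lemma upper_Ps_finite: "j \<le> 1 \<Longrightarrow> upper_Ps u p j t < \<infinity>"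
proof (cases j)
  case (Suc k)
  assume "j \<le> 1"
  then have "upper_Ps u p j t = (\<integral>\<^sup>+s\<in>einterval (ereal t) u. ennreal (p s) \<partial>lborel)" using Suc by simp
  also have "\<dots> \<le> (\<integral>\<^sup>+s. ennreal (p s) \<partial>lborel)" by (intro nn_integral_mono) (auto simp: indicator_def)
  also have "\<dots> < \<infinity>" using p_integrable p_nonneg by (subst nn_integral_eq_integral) auto
  finally show ?thesis .
qed simp

lemma PL_Suc:
  assumes "j \<le> 1" "lower_Ps l p (Suc j) x < \<infinity>"
  shows "set_integrable lborel (einterval l (ereal x)) (PL j)" "PL (Suc j) x = (LBINT v:einterval l (ereal x). PL j v)"
  using set_integrable_enn2real[of "lower_Ps l p j" lborel "einterval l (ereal x)"] assms lower_Ps_finite by auto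

lemma PU_Suc:
  assumes "j \<le> 1" "upper_Ps u p (Suc j) x < \<infinity>"
  shows "set_integrable lborel (einterval (ereal x) u) (PU j)" "PU (Suc j) x = (LBINT v:einterval (ereal x) u. PU j v)"
  using set_integrable_enn2real[of "upper_Ps u p j" lborel "einterval (ereal x) u"] assms upper_Ps_finite by auto

lemma L_Suc:
  assumes "j \<le> 1" "lower_Ps l p (Suc j) x < \<infinity>" "is_density_of f g"
    and "set_integrable lborel (einterval l (ereal x)) (\<lambda>v. PL (Suc j) v * f v)"
  shows "set_integrable lborel (einterval l (ereal x)) (\<lambda>v. PL j v * g v)"
    "L (Suc j) f x = g x * PL (Suc j) x - L j g x"
  using lower_integration_by_parts[where q="lower_Ps l p j" and l=l and x=x and f=f and g=g] assms lower_Ps_finite by (auto simp: L_def)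

lemma U_Suc:
  assumes "j \<le> 1" "upper_Ps u p (Suc j) x < \<infinity>" "is_density_of f g"
    and "set_integrable lborel (einterval (ereal x) u) (\<lambda>v. PU (Suc j) v * f v)"
  shows "set_integrable lborel (einterval (ereal x) u) (\<lambda>v. PU j v * g v)"
    "U (Suc j) f x = U j g x - g x * PU (Suc j) x"
  using upper_integration_by_parts[where q="upper_Ps u p j" and u=u and x=x and f=f and g=g] assms upper_Ps_finite by (auto simp: U_def)

lemma Icc_in_pieces:
  assumes "x \<in> pieces m e"
  obtains c b where "c < x" "x < b" "{c..b} \<subseteq> pieces m e"
proof -
  obtain r where "r > 0" "cball x r \<subseteq> pieces m e"
    using open_pieces assms open_contains_cball by metis
  then show ?thesis using that[of "x - r" "x + r"] by (simp add: cball_eq_atLeastAtMost)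
qed

lemma DERIV_lower:
  assumes x: "x \<in> pieces m e" and "continuous_on (pieces m e) \<phi>"
    and "\<And>y. y \<in> pieces m e \<Longrightarrow> set_integrable lborel (einterval l (ereal y)) \<phi>"
  shows "((\<lambda>y. LBINT v:einterval l (ereal y). \<phi> v) has_real_derivative \<phi> x) (at x)"
proof -
  obtain c b where cb: "c < x" "x < b" "{c..b} \<subseteq> pieces m e" using Icc_in_pieces[OF x] by blast
  then have "c \<in> pieces m e" "b \<in> pieces m e" by auto
  with cb show ?thesis using assms pieces_sub[of c]
    by (intro has_real_derivative_lower_integral[where b=b and c=c]) (auto intro: continuous_on_subset)
qed

lemma DERIV_upper:
  assumes x: "x \<in> pieces m e" and "continuous_on (pieces m e) \<phi>"
    and "\<And>y. y \<in> pieces m e \<Longrightarrow> set_integrable lborel (einterval (ereal y) u) \<phi>"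
  shows "((\<lambda>y. LBINT v:einterval (ereal y) u. \<phi> v) has_real_derivative - \<phi> x) (at x)"
proof -
  obtain c b where cb: "c < x" "x < b" "{c..b} \<subseteq> pieces m e" using Icc_in_pieces[OF x] by blast
  then have "c \<in> pieces m e" "b \<in> pieces m e" by auto
  with cb show ?thesis using assms pieces_sub[of b]
    by (intro has_real_derivative_upper_integral[where b=b and c=c]) (auto intro: continuous_on_subset)
qed

lemma DERIV_PL_Suc:
  assumes "x \<in> pieces m e" "j \<le> 1" "continuous_on (pieces m e) (PL j)"
    and fin: "\<And>y. y \<in> pieces m e \<Longrightarrow> lower_Ps l p (Suc j) y < \<infinity>"
  shows "(PL (Suc j) has_real_derivative PL j x) (at x)"
  using DERIV_lower[OF assms(1,3) PL_Suc(1)[OF assms(2) fin]]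
  by (rule has_field_derivative_transform_within_open[OF _ open_pieces assms(1)])
    (use PL_Suc(2)[OF assms(2) fin] in auto)

lemma DERIV_PU_Suc:
  assumes "x \<in> pieces m e" "j \<le> 1" "continuous_on (pieces m e) (PU j)"
    and fin: "\<And>y. y \<in> pieces m e \<Longrightarrow> upper_Ps u p (Suc j) y < \<infinity>"
  shows "(PU (Suc j) has_real_derivative - PU j x) (at x)"
  using DERIV_upper[OF assms(1,3) PU_Suc(1)[OF assms(2) fin]]
  by (rule has_field_derivative_transform_within_open[OF _ open_pieces assms(1)])
    (use PU_Suc(2)[OF assms(2) fin] in auto)

lemma DERIV_P1:
  assumes "x \<in> pieces m e"
  shows "(PL 1 has_real_derivative p x) (at x)" "(PU 1 has_real_derivative - p x) (at x)"
proof -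
  have P0': "PL 0 = p" "PU 0 = p" by (simp_all add: fun_eq_iff p_nonneg)
  show "(PL 1 has_real_derivative p x) (at x)" "(PU 1 has_real_derivative - p x) (at x)"
    using DERIV_PL_Suc[OF assms, of 0] DERIV_PU_Suc[OF assms, of 0] p_continuous
      lower_Ps_finite[of 1] upper_Ps_finite[of 1]
    unfolding P0' One_nat_def by (auto simp: p_nonneg)
qed

lemma DERIV_P2:
  assumes "x \<in> pieces m e" "\<And>y. y \<in> pieces m e \<Longrightarrow> lower_Ps l p 2 y < \<infinity> \<and> upper_Ps u p 2 y < \<infinity>"
  shows "(PL 2 has_real_derivative PL 1 x) (at x)" "(PU 2 has_real_derivative - PU 1 x) (at x)"
proof -
  have "continuous_on (pieces m e) (PL 1)" "continuous_on (pieces m e) (PU 1)"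
    unfolding continuous_on_eq_continuous_at[OF open_pieces] using DERIV_P1 DERIV_isCont by blast+
  then show "(PL 2 has_real_derivative PL 1 x) (at x)" "(PU 2 has_real_derivative - PU 1 x) (at x)"
    using DERIV_PL_Suc[OF assms(1), of 1] DERIV_PU_Suc[OF assms(1), of 1] assms(2)
    by (auto simp: Suc_1 simp del: lower_Ps.simps upper_Ps.simps One_nat_def)
qed

text \<open>Almost every point where \<open>p\<close> is positive lies either in the left or in the
  right tail of \<open>x\<close>; elsewhere both sides vanish.\<close>

lemma split_at:
  assumes x: "x \<in> pieces m e" and [measurable]: "g \<in> borel_measurable borel"
    and int: "integrable lborel (\<lambda>v. p v * g v)"
  shows "set_integrable lborel (einterval l (ereal x)) (\<lambda>v. p v * g v)"
    "set_integrable lborel (einterval (ereal x) u) (\<lambda>v. p v * g v)"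
    "(LINT v|lborel. p v * g v) = L 0 g x + U 0 g x"
proof -
  show 1: "set_integrable lborel (einterval l (ereal x)) (\<lambda>v. p v * g v)"
    "set_integrable lborel (einterval (ereal x) u) (\<lambda>v. p v * g v)"
    unfolding set_integrable_def using int by (simp_all only: integrable_mult_indicator sets_lborel borel_einterval)
  have "(LINT v|lborel. p v * g v) = (LINT v|lborel. indicator (einterval l (ereal x)) v * (p v * g v)
      + indicator (einterval (ereal x) u) v * (p v * g v))"
  proof (rule integral_cong_AE)
    show "AE v in lborel. p v * g v = indicator (einterval l (ereal x)) v * (p v * g v)
      + indicator (einterval (ereal x) u) v * (p v * g v)"
      using AE_pieces[of x]
    proof eventually_elim
      case (elim v)
      show ?case
      proof (cases "v \<in> pieces m e")
        case True
        then have "v \<in> einterval l (ereal x) \<longleftrightarrow> v < x" "v \<in> einterval (ereal x) u \<longleftrightarrow> x < v"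
          using pieces_sub by (auto simp: einterval_def)
        then show ?thesis using elim by (auto simp: indicator_def)
      next
        case False
        then have "p v = 0" using p_nonneg[of v] by (simp add: in_pieces)
        then show ?thesis by simp
      qed
    qed
  qed measurable
  also have "\<dots> = L 0 g x + U 0 g x"
    using 1 by (simp add: L_def U_def set_lebesgue_integral_def set_integrable_def p_nonneg)
  finally show "(LINT v|lborel. p v * g v) = L 0 g x + U 0 g x" .
qed

lemma P1_sum:
  assumes "x \<in> pieces m e"
  shows "PL 1 x + PU 1 x = 1"
  using split_at[OF assms, of "\<lambda>_. 1"] p_integrable PL_Suc(2)[of 0 x] PU_Suc(2)[of 0 x]
    lower_Ps_finite[of 1] upper_Ps_finite[of 1]
  by (simp add: L_def U_def p_nonneg)

section \<open>Kernel expectations as tail integrals\<close>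

text \<open>On the pieces the factor \<open>p v\<close> cancels \<open>1 / p v\<close>. Off the
  pieces \<open>p v\<close> is 0, and almost every such point is outside both tails, so the right
  side vanishes as well.\<close>

lemma K_density_eq:
  assumes x: "x \<in> pieces m e"
  shows "AE v in lborel. p v * (K i j x v * g v) =
    (-1) ^ j * mU i x * (indicator (einterval l (ereal x)) v * (PL j v * g v))
    - mL i x * (indicator (einterval (ereal x) u) v * (PU j v * g v))"
  using AE_pieces[of x]
proof eventually_elim
  case (elim v)
  show ?case
  proof (cases "v \<in> pieces m e")
    case True
    then have iff: "v \<in> einterval l (ereal x) \<longleftrightarrow> v < x" "v \<in> einterval (ereal x) u \<longleftrightarrow> x < v"
      using pieces_sub by (auto simp: einterval_def)
    have "p v * (K i j x v * g v) = ((-1) ^ j * mU i x * PL j v * of_bool (v \<le> x)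
        - mL i x * PU j v * of_bool (v > x)) * g v"
      using True by (simp add: K_kernel_def in_pieces)
    then show ?thesis using iff elim by (auto simp: indicator_def algebra_simps)
  next
    case False
    then have "v \<notin> einterval l u" using elim by simp
    then have "v \<notin> einterval l (ereal x)" "v \<notin> einterval (ereal x) u"
      using pieces_sub[OF x] less_trans[of "ereal v" "ereal x" u] less_trans[of l "ereal x" "ereal v"]
      by (auto simp: einterval_def)
    moreover have "p v = 0" using False p_nonneg[of v] by (simp add: in_pieces)
    ultimately show ?thesis by simp
  qed
qed

text \<open>The left and right contributions live on disjoint tails, so multiplying their difference
  by an indicator isolates each one and integrability separates. A coefficient equal to 0 imposes no
  condition on its tail.\<close>

lemma
  assumes x: "x \<in> pieces m e" and [measurable]: "g \<in> borel_measurable borel"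
  shows K_integrable_iff: "integrable M (\<lambda>\<omega>. K i j x (Z \<omega>) * g (Z \<omega>)) \<longleftrightarrow>
      (mU i x \<noteq> 0 \<longrightarrow> set_integrable lborel (einterval l (ereal x)) (\<lambda>v. PL j v * g v)) \<and>
      (mL i x \<noteq> 0 \<longrightarrow> set_integrable lborel (einterval (ereal x) u) (\<lambda>v. PU j v * g v))" (is "?I \<longleftrightarrow> ?R")
    and K_expectation: "integrable M (\<lambda>\<omega>. K i j x (Z \<omega>) * g (Z \<omega>)) \<Longrightarrow>
      (LINT \<omega>|M. K i j x (Z \<omega>) * g (Z \<omega>)) = (-1) ^ j * mU i x * L j g x - mL i x * U j g x"
proof -
  let ?A = "\<lambda>v. (-1) ^ j * mU i x * (indicator (einterval l (ereal x)) v * (PL j v * g v))"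
  let ?B = "\<lambda>v. mL i x * (indicator (einterval (ereal x) u) v * (PU j v * g v))"
  have "?I \<longleftrightarrow> integrable lborel (\<lambda>v. p v * (K i j x v * g v))"
    using p_nonneg by (intro distributed_integrable[OF distr, symmetric]) auto
  also have "\<dots> \<longleftrightarrow> integrable lborel (\<lambda>v. ?A v - ?B v)"
    by (intro integrable_cong_AE K_density_eq[OF x]) measurable
  finally have I: "?I \<longleftrightarrow> integrable lborel (\<lambda>v. ?A v - ?B v)" .
  have AB: "?R \<longleftrightarrow> integrable lborel ?A \<and> integrable lborel ?B"
    unfolding integrable_mult_right_cancel by (simp add: set_integrable_def)
  have sep: "integrable lborel ?A \<and> integrable lborel ?B" if "integrable lborel (\<lambda>v. ?A v - ?B v)"
  proof
    have "integrable lborel (\<lambda>v. indicator (einterval l (ereal x)) v *\<^sub>R (?A v - ?B v))"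
      by (rule integrable_mult_indicator[OF _ that]) simp
    moreover have "(\<lambda>v. indicator (einterval l (ereal x)) v *\<^sub>R (?A v - ?B v)) = ?A"
      by (auto simp: indicator_def einterval_def fun_eq_iff)
    ultimately show "integrable lborel ?A" by simp
    have "integrable lborel (\<lambda>v. indicator (einterval (ereal x) u) v *\<^sub>R (?B v - ?A v))"
      by (rule integrable_mult_indicator) (use integrable_minus[OF that] in \<open>simp_all\<close>)
    moreover have "(\<lambda>v. indicator (einterval (ereal x) u) v *\<^sub>R (?B v - ?A v)) = ?B"
      by (auto simp: indicator_def einterval_def fun_eq_iff)
    ultimately show "integrable lborel ?B" by simp
  qed
  have both: "integrable lborel (\<lambda>v. ?A v - ?B v) \<longleftrightarrow> integrable lborel ?A \<and> integrable lborel ?B"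
    by (rule iffI[OF sep], assumption, elim conjE) (rule Bochner_Integration.integrable_diff)
  show "?I \<longleftrightarrow> ?R" unfolding AB I both by (rule refl)
  assume "?I"
  then have "integrable lborel (\<lambda>v. ?A v - ?B v)" unfolding I .
  note int = conjunct1[OF sep[OF this]] conjunct2[OF sep[OF this]]
  have "(LINT \<omega>|M. K i j x (Z \<omega>) * g (Z \<omega>)) = (LINT v|lborel. p v * (K i j x v * g v))"
    using p_nonneg by (intro distributed_integral[OF distr, symmetric]) auto
  also have "\<dots> = (LINT v|lborel. ?A v - ?B v)"
    by (intro integral_cong_AE K_density_eq[OF x]) measurable
  also have "\<dots> = (LINT v|lborel. ?A v) - (LINT v|lborel. ?B v)" using int by (rule Bochner_Integration.integral_diff)
  also have "\<dots> = (-1) ^ j * mU i x * L j g x - mL i x * U j g x"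
    by (simp add: L_def U_def set_lebesgue_integral_def)
  finally show "(LINT \<omega>|M. K i j x (Z \<omega>) * g (Z \<omega>)) = (-1) ^ j * mU i x * L j g x - mL i x * U j g x" .
qed

lemma AE_distr:
  assumes "AE v in lborel. Q v"
  shows "AE \<omega> in M. Q (Z \<omega>)"
proof -
  have "AE v in density lborel (\<lambda>x. ennreal (p x)). Q v"
    using assms by (subst AE_density) auto
  then have "AE v in distr M lborel Z. Q v"
    unfolding distributed_distr_eq_density[OF distr] .
  then show ?thesis by (rule AE_distrD[rotated]) simp
qed

text \<open>Allows \<open>deriv g\<close> to be exchanged for a Borel density: the law of
  \<open>Z\<close> has a Lebesgue density, so equality almost everywhere suffices.\<close>

lemma K_integral_cong:
  assumes [measurable]: "g \<in> borel_measurable borel" and eq: "AE v in lborel. g' v = g v"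
    and int: "integrable M (\<lambda>\<omega>. K i j x (Z \<omega>) * g' (Z \<omega>))"
  shows "integrable M (\<lambda>\<omega>. K i j x (Z \<omega>) * g (Z \<omega>))"
    "(LINT \<omega>|M. K i j x (Z \<omega>) * g' (Z \<omega>)) = (LINT \<omega>|M. K i j x (Z \<omega>) * g (Z \<omega>))"
proof -
  have AE: "AE \<omega> in M. K i j x (Z \<omega>) * g' (Z \<omega>) = K i j x (Z \<omega>) * g (Z \<omega>)"
    using AE_distr[OF eq] by eventually_elim simp
  note [measurable] = borel_measurable_integrable[OF int]
  have [measurable]: "(\<lambda>\<omega>. K i j x (Z \<omega>) * g (Z \<omega>)) \<in> borel_measurable M" by measurable
  show "integrable M (\<lambda>\<omega>. K i j x (Z \<omega>) * g (Z \<omega>))"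
    using int AE by (subst integrable_cong_AE[symmetric]) auto
  show "(LINT \<omega>|M. K i j x (Z \<omega>) * g' (Z \<omega>)) = (LINT \<omega>|M. K i j x (Z \<omega>) * g (Z \<omega>))"
    using AE by (intro integral_cong_AE) auto
qed

end

section \<open>Derivatives of the Stein solution\<close>

context stein_setting
begin

text \<open>Regularity through order \<open>i + 1\<close> gives differentiability of the derivatives
  of order \<open>k \<le> i\<close>, so \<open>deriv ^^ Suc k\<close> is a genuine derivative there
  and not a default value.\<close>

lemma kernel_hypD:
  assumes H: "kernel_hyp M Z m e p w i j g" and x: "x \<in> pieces m e"
  shows "lower_Ps l p (Suc j) x < \<infinity>" "upper_Ps u p (Suc j) x < \<infinity>"
    "k \<le> i \<Longrightarrow> (mL k has_real_derivative mL (Suc k) x) (at x)"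
    "k \<le> i \<Longrightarrow> (mU k has_real_derivative mU (Suc k) x) (at x)"
    "locally_abs_continuous_on UNIV g"
    "integrable M (\<lambda>\<omega>. K i j x (Z \<omega>) * g (Z \<omega>))"
    "integrable M (\<lambda>\<omega>. K i (Suc j) x (Z \<omega>) * deriv g (Z \<omega>))"
    "integrable M (\<lambda>\<omega>. K (Suc i) j x (Z \<omega>) * g (Z \<omega>))"
proof -
  note * = bspec[OF H[unfolded kernel_hyp_def Let_def, folded l_eq u_eq] x, unfolded Suc_eq_plus1[symmetric]]
  show "lower_Ps l p (Suc j) x < \<infinity>" "upper_Ps u p (Suc j) x < \<infinity>"
    "locally_abs_continuous_on UNIV g"
    "integrable M (\<lambda>\<omega>. K i j x (Z \<omega>) * g (Z \<omega>))"
    "integrable M (\<lambda>\<omega>. K i (Suc j) x (Z \<omega>) * deriv g (Z \<omega>))"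
    "integrable M (\<lambda>\<omega>. K (Suc i) j x (Z \<omega>) * g (Z \<omega>))"
    using * by blast+
  have "derivs_loc_abs_continuous_near (Suc i) (lower_m l p w) x" "derivs_loc_abs_continuous_near (Suc i) (upper_m u p w) x"
    using * by blast+
  then have "mL k differentiable (at x)" "mU k differentiable (at x)" if "k \<le> i"
    using that unfolding derivs_loc_abs_continuous_near_def by force+
  then show "k \<le> i \<Longrightarrow> (mL k has_real_derivative mL (Suc k) x) (at x)"
    "k \<le> i \<Longrightarrow> (mU k has_real_derivative mU (Suc k) x) (at x)"
    using DERIV_deriv_iff_real_differentiable by auto
qed

section \<open>Relations between the lower and upper \<open>m\<close>\<close>

lemma m0_eq:
  assumes "x \<in> pieces m e"
  shows "mU 0 x = PU 1 x / (w x * p x)" "mL 0 x = PL 1 x / (w x * p x)"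
proof -
  have "l \<le> ereal x" "ereal x \<le> u" using pieces_sub[OF assms] by auto
  then show "mU 0 x = PU 1 x / (w x * p x)" "mL 0 x = PL 1 x / (w x * p x)"
    using PL_Suc(2)[of 0 x] PU_Suc(2)[of 0 x] lower_Ps_finite[of 1] upper_Ps_finite[of 1]
    by (simp_all add: lower_m_def upper_m_def lower_P_def upper_P_def interval_lebesgue_integral_def p_nonneg)
qed

text \<open>Both sides of the first equation are \<open>PL 1 x * PU 1 x / (w x * p x)\<close>; the
  second follows from \<open>PL 1 x + PU 1 x = 1\<close>.\<close>

lemma m0_relations:
  assumes "x \<in> pieces m e"
  shows "mU 0 x * PL 1 x = mL 0 x * PU 1 x" "(mU 0 x + mL 0 x) * p x = 1 / w x"
proof -
  have "w x \<noteq> 0" "p x > 0" using w_nonzero assms by (auto simp: in_pieces)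
  moreover have "PU 1 x = 1 - PL 1 x" using P1_sum[OF assms] by linarith
  ultimately show "mU 0 x * PL 1 x = mL 0 x * PU 1 x" "(mU 0 x + mL 0 x) * p x = 1 / w x"
    unfolding m0_eq[OF assms] by (simp_all add: field_simps)
qed

text \<open>The first identity of \<open>m0_relations\<close> holds on an open set and may be
  differentiated. The terms containing \<open>p\<close> combine to \<open>1 / w x\<close>, so
  \<open>w\<close> itself is never differentiated.\<close>

lemma m1_relation:
  assumes x: "x \<in> pieces m e"
    and "(mU 0 has_real_derivative mU 1 x) (at x)" "(mL 0 has_real_derivative mL 1 x) (at x)"
  shows "mU 1 x * PL 1 x - mL 1 x * PU 1 x = - 1 / w x"
proof -
  have "((\<lambda>y. mU 0 y * PL 1 y - mL 0 y * PU 1 y) has_real_derivative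
      mU 1 x * PL 1 x + p x * mU 0 x - (mL 1 x * PU 1 x + - p x * mL 0 x)) (at x)"
    using assms DERIV_P1[OF x] by (intro DERIV_diff DERIV_mult)
  moreover have "((\<lambda>y. mU 0 y * PL 1 y - mL 0 y * PU 1 y) has_real_derivative 0) (at x)"
    by (rule has_field_derivative_transform_within_open[where f="\<lambda>_. 0", OF DERIV_const open_pieces x])
      (simp only: m0_relations(1) diff_self)
  ultimately have "mU 1 x * PL 1 x + p x * mU 0 x - (mL 1 x * PU 1 x + - p x * mL 0 x) = 0"
    by (rule DERIV_unique)
  then show ?thesis using m0_relations(2)[OF x] by (simp add: algebra_simps)
qed

section \<open>Solution, Stein kernel and expectations through tail integrals\<close>

lemma density_integrable:
  assumes "integrable (density lborel (\<lambda>x. ennreal (p x))) h"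
  shows "h \<in> borel_measurable borel" "integrable lborel (\<lambda>v. p v * h v)"
    "(LINT \<omega>|M. h (Z \<omega>)) = (LINT v|lborel. p v * h v)"
proof -
  show h: "h \<in> borel_measurable borel" using borel_measurable_integrable[OF assms] by simp
  show "integrable lborel (\<lambda>v. p v * h v)"
    using assms h p_nonneg by (subst (asm) integrable_real_density) auto
  show "(LINT \<omega>|M. h (Z \<omega>)) = (LINT v|lborel. p v * h v)"
    using distributed_integral[OF distr, of h] h p_nonneg by simp
qed

text \<open>The mean is \<open>L 0 h x + U 0 h x\<close>. Inserting it into the centered integral
  and using \<open>PU 1 x = 1 - PL 1 x\<close> gives
  \<open>PU 1 x * L 0 h x - PL 1 x * U 0 h x\<close>.\<close>

lemma stein_solution_eq:
  assumes x: "x \<in> pieces m e" and h: "integrable (density lborel (\<lambda>x. ennreal (p x))) h"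
  shows "stein_solution M Z l p w h x = mU 0 x * L 0 h x - mL 0 x * U 0 h x"
proof -
  note h' = density_integrable[OF h]
  note sp = split_at[OF x h'(1,2)]
  define \<mu> where "\<mu> = (LINT \<omega>|M. h (Z \<omega>))"
  have pA: "set_integrable lborel (einterval l (ereal x)) p" "(LBINT v:einterval l (ereal x). p v) = PL 1 x"
    using PL_Suc[of 0 x] lower_Ps_finite[of 1] by (simp_all add: p_nonneg)
  have "(LBINT t=l..ereal x. (h t - \<mu>) * p t) = (LBINT t:einterval l (ereal x). p t * h t - \<mu> * p t)"
    using pieces_sub[OF x] by (simp add: interval_lebesgue_integral_def less_imp_le algebra_simps)
  also have "\<dots> = L 0 h x - \<mu> * PL 1 x"
    using sp(1) pA by (subst set_integral_diff(2)) (auto simp: L_def p_nonneg)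
  finally have eq: "(LBINT t=l..ereal x. (h t - \<mu>) * p t) = L 0 h x - \<mu> * PL 1 x" .
  have \<mu>: "\<mu> = L 0 h x + U 0 h x"
    unfolding \<mu>_def h'(3) sp(3) ..
  have PU: "PU 1 x = 1 - PL 1 x" using P1_sum[OF x] by linarith
  have "L 0 h x - \<mu> * PL 1 x = PU 1 x * L 0 h x - PL 1 x * U 0 h x"
    unfolding \<mu> PU by (simp add: algebra_simps del: lower_Ps.simps)
  then show ?thesis
    unfolding stein_solution_def \<mu>_def[symmetric] m0_eq[OF x] eq
    by (simp add: diff_divide_distrib del: lower_Ps.simps upper_Ps.simps)
qed

text \<open>The left side is minus the Stein solution of the identity function. Integration by parts
  with the constant density 1 expresses \<open>PL 2\<close> and \<open>PU 2\<close> through the tail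
  integrals of the identity, and the terms with factor \<open>x\<close> cancel by
  \<open>m0_relations\<close>.\<close>

lemma stein_tau_eq:
  assumes x: "x \<in> pieces m e" and Z: "integrable M Z"
    and fin: "lower_Ps l p 2 x < \<infinity>" "upper_Ps u p 2 x < \<infinity>"
  shows "stein_tau M Z l p x / w x = mU 0 x * PL 2 x + mL 0 x * PU 2 x"
proof -
  have "integrable lborel (\<lambda>v. p v * v)"
    using distributed_integrable[OF distr, of "\<lambda>x. x"] Z p_nonneg by simp
  then have id: "integrable (density lborel (\<lambda>x. ennreal (p x))) (\<lambda>x. x)"
    using p_nonneg by (subst integrable_real_density) auto
  have dens: "is_density_of (\<lambda>_. 1) (\<lambda>t. t)"
    by (auto simp: is_density_of_def set_lebesgue_integral_def intro: borel_integrable_atLeastAtMost')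
  have fin': "lower_Ps l p (Suc 1) x < \<infinity>" "upper_Ps u p (Suc 1) x < \<infinity>"
    using fin by (simp_all only: Suc_1)
  have "PL 2 x = L 1 (\<lambda>_. 1) x" "PU 2 x = U 1 (\<lambda>_. 1) x"
    using PL_Suc(2)[OF order_refl fin'(1), unfolded Suc_1] PU_Suc(2)[OF order_refl fin'(2), unfolded Suc_1]
    by (simp_all only: L_def U_def mult_1_right)
  moreover have "L 1 (\<lambda>_. 1) x = x * PL 1 x - L 0 (\<lambda>t. t) x"
    unfolding One_nat_def
    by (rule L_Suc(2)[OF _ _ dens]) (use PL_Suc(1)[OF _ fin'(1)] lower_Ps_finite in \<open>auto simp del: lower_Ps.simps\<close>)
  moreover have "U 1 (\<lambda>_. 1) x = U 0 (\<lambda>t. t) x - x * PU 1 x"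
    unfolding One_nat_def
    by (rule U_Suc(2)[OF _ _ dens]) (use PU_Suc(1)[OF _ fin'(2)] upper_Ps_finite in \<open>auto simp del: upper_Ps.simps\<close>)
  ultimately have P2: "PL 2 x = x * PL 1 x - L 0 (\<lambda>t. t) x" "PU 2 x = U 0 (\<lambda>t. t) x - x * PU 1 x"
    by simp_all
  have "mU 0 x * PL 2 x + mL 0 x * PU 2 x =
      - (mU 0 x * L 0 (\<lambda>t. t) x - mL 0 x * U 0 (\<lambda>t. t) x) + x * (mU 0 x * PL 1 x - mL 0 x * PU 1 x)"
    unfolding P2 by (simp only: algebra_simps)
  also have "\<dots> = - stein_solution M Z l p w (\<lambda>t. t) x"
    unfolding stein_solution_eq[OF x id] m0_relations(1)[OF x] by simp
  also have "\<dots> = stein_tau M Z l p x / w x"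
  proof -
    have "(LBINT t=l..ereal x. ((LINT \<omega>|M. Z \<omega>) - t) * p t) = - (LBINT t=l..ereal x. (t - (LINT \<omega>|M. Z \<omega>)) * p t)"
      by (subst interval_lebesgue_integral_uminus[symmetric]) (simp add: algebra_simps)
    then show ?thesis by (simp add: stein_tau_def stein_solution_def mult.commute)
  qed
  finally show ?thesis ..
qed

text \<open>One integration by parts in each tail, after \<open>deriv h\<close> has been replaced by
  a density of \<open>h\<close>.\<close>

lemma K_deriv_expectation:
  assumes x: "x \<in> pieces m e" and h: "locally_abs_continuous_on UNIV h"
    and int: "integrable M (\<lambda>\<omega>. K i 1 x (Z \<omega>) * deriv h (Z \<omega>))"
  shows "(LINT \<omega>|M. K i 1 x (Z \<omega>) * deriv h (Z \<omega>)) =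
    mU i x * (L 0 h x - h x * PL 1 x) - mL i x * (U 0 h x - h x * PU 1 x)"
proof -
  obtain f where f: "is_density_of f h" "AE v in lborel. deriv h v = f v"
    using loc_abs_continuous_is_density[OF h] by blast
  have fm: "f \<in> borel_measurable borel" using f(1) by (simp add: is_density_of_def)
  note cong = K_integral_cong[OF fm f(2) int]
  note iff = K_integrable_iff[OF x fm, THEN iffD1, OF cong(1)]
  \<comment> \<open>Integrability on a tail is known only for a nonzero coefficient. Otherwise the
    product with the coefficient is 0 whatever the value of the tail integral.\<close>
  have L: "L 1 f x = h x * PL 1 x - L 0 h x" if "mU i x \<noteq> 0"
    using L_Suc(2)[of 0 x f h] f(1) iff that lower_Ps_finite[of 1] by simp
  have U: "U 1 f x = U 0 h x - h x * PU 1 x" if "mL i x \<noteq> 0"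
    using U_Suc(2)[of 0 x f h] f(1) iff that upper_Ps_finite[of 1] by simp
  have "(LINT \<omega>|M. K i 1 x (Z \<omega>) * deriv h (Z \<omega>)) = (-1) ^ 1 * mU i x * L 1 f x - mL i x * U 1 f x"
    unfolding cong(2) by (rule K_expectation[OF x fm cong(1)])
  moreover have "mU i x * L 1 f x = mU i x * (h x * PL 1 x - L 0 h x)" using L by auto
  moreover have "mL i x * U 1 f x = mL i x * (U 0 h x - h x * PU 1 x)" using U by auto
  ultimately show ?thesis by (simp add: algebra_simps)
qed

text \<open>Two integrations by parts in each tail, from \<open>f\<close> to \<open>g\<close> and
  from \<open>g\<close> to \<open>h\<close>. The first one leaves the boundary terms with
  \<open>PL 2\<close>, \<open>PU 2\<close> and the value \<open>g x\<close>.\<close>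

lemma K_deriv2_expectation:
  assumes x: "x \<in> pieces m e" and g: "locally_abs_continuous_on UNIV g" and h: "is_density_of g h"
    and fin: "lower_Ps l p 2 x < \<infinity>" "upper_Ps u p 2 x < \<infinity>"
    and int: "integrable M (\<lambda>\<omega>. K i 2 x (Z \<omega>) * deriv g (Z \<omega>))"
  shows "(LINT \<omega>|M. K i 2 x (Z \<omega>) * deriv g (Z \<omega>)) =
    mU i x * (L 0 h x - h x * PL 1 x) - mL i x * (U 0 h x - h x * PU 1 x)
    + (mU i x * PL 2 x + mL i x * PU 2 x) * g x"
proof -
  obtain f where f: "is_density_of f g" "AE v in lborel. deriv g v = f v"
    using loc_abs_continuous_is_density[OF g] by blast
  have fm: "f \<in> borel_measurable borel" using f(1) by (simp add: is_density_of_def)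
  note cong = K_integral_cong[OF fm f(2) int]
  note iff = K_integrable_iff[OF x fm, THEN iffD1, OF cong(1)]
  have fin': "lower_Ps l p (Suc 1) x < \<infinity>" "upper_Ps u p (Suc 1) x < \<infinity>"
    using fin by (simp_all only: Suc_1)
  have fin1: "lower_Ps l p (Suc 0) x < \<infinity>" "upper_Ps u p (Suc 0) x < \<infinity>"
    using lower_Ps_finite[of "Suc 0"] upper_Ps_finite[of "Suc 0"] by auto
  have L: "L 2 f x = g x * PL 2 x - (h x * PL 1 x - L 0 h x)" if "mU i x \<noteq> 0"
  proof -
    have *: "set_integrable lborel (einterval l (ereal x)) (\<lambda>v. PL (Suc 1) v * f v)"
      unfolding Suc_1 using iff that by blast
    note L1 = L_Suc[OF order_refl fin'(1) f(1) *, unfolded Suc_1]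
    have "L 1 g x = h x * PL 1 x - L 0 h x"
      using L_Suc(2)[OF _ fin1(1) h] L1(1) by simp
    then show ?thesis using L1(2) by simp
  qed
  have U: "U 2 f x = (U 0 h x - h x * PU 1 x) - g x * PU 2 x" if "mL i x \<noteq> 0"
  proof -
    have *: "set_integrable lborel (einterval (ereal x) u) (\<lambda>v. PU (Suc 1) v * f v)"
      unfolding Suc_1 using iff that by blast
    note U1 = U_Suc[OF order_refl fin'(2) f(1) *, unfolded Suc_1]
    have "U 1 g x = U 0 h x - h x * PU 1 x"
      using U_Suc(2)[OF _ fin1(2) h] U1(1) by simp
    then show ?thesis using U1(2) by simp
  qed
  have "(LINT \<omega>|M. K i 2 x (Z \<omega>) * deriv g (Z \<omega>)) = (-1) ^ 2 * mU i x * L 2 f x - mL i x * U 2 f x"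
    unfolding cong(2) by (rule K_expectation[OF x fm cong(1)])
  moreover have "mU i x * L 2 f x = mU i x * (g x * PL 2 x - (h x * PL 1 x - L 0 h x))" using L by auto
  moreover have "mL i x * U 2 f x = mL i x * ((U 0 h x - h x * PU 1 x) - g x * PU 2 x)" using U by auto
  ultimately show ?thesis by (simp add: algebra_simps)
qed

text \<open>Equals the first derivative of the Stein solution for \<open>i = 1\<close>, and the second one up to \<open>h' / w\<close> for \<open>i = 2\<close>.\<close>

definition stein_deriv :: "(real \<Rightarrow> real) \<Rightarrow> nat \<Rightarrow> real \<Rightarrow> real" where
  "stein_deriv h i x = mU i x * (L 0 h x - h x * PL 1 x) - mL i x * (U 0 h x - h x * PU 1 x)"

section \<open>Differentiation of the Stein solution and of the Stein kernel\<close>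

lemma DERIV_L0_U0:
  assumes x: "x \<in> pieces m e" and h: "integrable (density lborel (\<lambda>x. ennreal (p x))) h"
    and cont: "continuous_on UNIV h"
  shows "(L 0 h has_real_derivative p x * h x) (at x)" "(U 0 h has_real_derivative - (p x * h x)) (at x)"
proof -
  have c: "continuous_on (pieces m e) (\<lambda>v. p v * h v)"
    by (intro continuous_on_mult p_continuous continuous_on_subset[OF cont]) simp
  note sp = split_at[OF _ density_integrable(1,2)[OF h]]
  show "(L 0 h has_real_derivative p x * h x) (at x)" "(U 0 h has_real_derivative - (p x * h x)) (at x)"
    using DERIV_lower[OF x c sp(1)] DERIV_upper[OF x c sp(2)]
    unfolding L_def[abs_def] U_def[abs_def] P0 by simp_all
qed

text \<open>The product rule produces the extra term \<open>(mU 0 x + mL 0 x) * p x * h x\<close>.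
  By \<open>m1_relation\<close> its factor equals
  \<open>- (mU 1 x * PL 1 x - mL 1 x * PU 1 x)\<close>, which subtracts \<open>h x\<close> times
  \<open>PL 1\<close> and \<open>PU 1\<close> from the tail integrals.\<close>

lemma DERIV_stein_solution:
  assumes x: "x \<in> pieces m e" and h: "integrable (density lborel (\<lambda>x. ennreal (p x))) h"
    and cont: "continuous_on UNIV h"
    and m: "(mU 0 has_real_derivative mU 1 x) (at x)" "(mL 0 has_real_derivative mL 1 x) (at x)"
  shows "(stein_solution M Z l p w h has_real_derivative stein_deriv h 1 x) (at x)"
proof -
  note LU = DERIV_L0_U0[OF x h cont]
  have "((\<lambda>y. mU 0 y * L 0 h y - mL 0 y * U 0 h y) has_real_derivative
      mU 1 x * L 0 h x + p x * h x * mU 0 x - (mL 1 x * U 0 h x + - (p x * h x) * mL 0 x)) (at x)"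
    using m LU by (intro DERIV_diff DERIV_mult)
  also have "mU 1 x * L 0 h x + p x * h x * mU 0 x - (mL 1 x * U 0 h x + - (p x * h x) * mL 0 x)
      = mU 1 x * L 0 h x - mL 1 x * U 0 h x + ((mU 0 x + mL 0 x) * p x) * h x"
    by (simp add: algebra_simps)
  also have "(mU 0 x + mL 0 x) * p x = - (mU 1 x * PL 1 x - mL 1 x * PU 1 x)"
    using m1_relation[OF x m] m0_relations(2)[OF x] by simp
  also have "mU 1 x * L 0 h x - mL 1 x * U 0 h x + - (mU 1 x * PL 1 x - mL 1 x * PU 1 x) * h x = stein_deriv h 1 x"
    by (simp add: stein_deriv_def algebra_simps)
  finally show ?thesis
    by (rule has_field_derivative_transform_within_open[OF _ open_pieces x]) (simp add: stein_solution_eq[OF _ h])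
qed

text \<open>The terms with \<open>p x * h x\<close> cancel within each tail. What remains besides
  \<open>stein_deriv h 2 x\<close> is \<open>h'\<close> times the expression of
  \<open>m1_relation\<close>, with a minus sign.\<close>

lemma DERIV_stein_deriv:
  assumes x: "x \<in> pieces m e" and h: "integrable (density lborel (\<lambda>x. ennreal (p x))) h"
    and cont: "continuous_on UNIV h" and dh: "(h has_real_derivative h') (at x)"
    and m0: "(mU 0 has_real_derivative mU 1 x) (at x)" "(mL 0 has_real_derivative mL 1 x) (at x)"
    and m1: "(mU 1 has_real_derivative mU 2 x) (at x)" "(mL 1 has_real_derivative mL 2 x) (at x)"
  shows "(stein_deriv h 1 has_real_derivative stein_deriv h 2 x + 1 / w x * h') (at x)"
proof -
  note LU = DERIV_L0_U0[OF x h cont]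
  have "(stein_deriv h 1 has_real_derivative
      mU 2 x * (L 0 h x - h x * PL 1 x) + (p x * h x - (h' * PL 1 x + p x * h x)) * mU 1 x
      - (mL 2 x * (U 0 h x - h x * PU 1 x) + (- (p x * h x) - (h' * PU 1 x + - p x * h x)) * mL 1 x)) (at x)"
    unfolding stein_deriv_def[abs_def] using m1 LU dh DERIV_P1[OF x]
    by (intro DERIV_diff DERIV_mult)
  then show ?thesis
  proof (rule DERIV_cong)
    show "mU 2 x * (L 0 h x - h x * PL 1 x) + (p x * h x - (h' * PL 1 x + p x * h x)) * mU 1 x
      - (mL 2 x * (U 0 h x - h x * PU 1 x) + (- (p x * h x) - (h' * PU 1 x + - p x * h x)) * mL 1 x)
      = stein_deriv h 2 x + 1 / w x * h'"
    proof -
      have "1 / w x * h' = - ((mU 1 x * PL 1 x - mL 1 x * PU 1 x) * h')"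
        unfolding m1_relation[OF x m0] by simp
      then show ?thesis by (simp add: stein_deriv_def algebra_simps)
    qed
  qed
qed

text \<open>The derivatives of \<open>PL 2\<close> and \<open>PU 2\<close> contribute
  \<open>mU 0 x * PL 1 x - mL 0 x * PU 1 x\<close>, which vanishes.\<close>

lemma DERIV_stein_tau:
  assumes x: "x \<in> pieces m e" and Z: "integrable M Z"
    and fin: "\<And>y. y \<in> pieces m e \<Longrightarrow> lower_Ps l p 2 y < \<infinity> \<and> upper_Ps u p 2 y < \<infinity>"
    and m0: "(mU 0 has_real_derivative mU 1 x) (at x)" "(mL 0 has_real_derivative mL 1 x) (at x)"
  shows "((\<lambda>y. stein_tau M Z l p y / w y) has_real_derivative mU 1 x * PL 2 x + mL 1 x * PU 2 x) (at x)"
proof -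
  have "((\<lambda>y. mU 0 y * PL 2 y + mL 0 y * PU 2 y) has_real_derivative
      (mU 1 x * PL 2 x + PL 1 x * mU 0 x) + (mL 1 x * PU 2 x + - PU 1 x * mL 0 x)) (at x)"
    using m0 DERIV_P2[OF x fin] by (intro DERIV_add DERIV_mult)
  also have "(mU 1 x * PL 2 x + PL 1 x * mU 0 x) + (mL 1 x * PU 2 x + - PU 1 x * mL 0 x)
      = mU 1 x * PL 2 x + mL 1 x * PU 2 x"
    using m0_relations(1)[OF x] by (simp add: mult.commute)
  finally show ?thesis
    by (rule has_field_derivative_transform_within_open[OF _ open_pieces x]) (use stein_tau_eq[OF _ Z] fin in auto)
qed

text \<open>Same computation one order higher: the contribution of \<open>PL 2\<close> and
  \<open>PU 2\<close> is now the left side of \<open>m1_relation\<close>, that is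
  \<open>- 1 / w x\<close>.\<close>

lemma DERIV_deriv_stein_tau:
  assumes x: "x \<in> pieces m e" and Z: "integrable M Z"
    and fin: "\<And>y. y \<in> pieces m e \<Longrightarrow> lower_Ps l p 2 y < \<infinity> \<and> upper_Ps u p 2 y < \<infinity>"
    and m0: "\<And>y. y \<in> pieces m e \<Longrightarrow> (mU 0 has_real_derivative mU 1 y) (at y)"
      "\<And>y. y \<in> pieces m e \<Longrightarrow> (mL 0 has_real_derivative mL 1 y) (at y)"
    and m1: "(mU 1 has_real_derivative mU 2 x) (at x)" "(mL 1 has_real_derivative mL 2 x) (at x)"
  shows "(deriv (\<lambda>y. stein_tau M Z l p y / w y) has_real_derivative mU 2 x * PL 2 x + mL 2 x * PU 2 x - 1 / w x) (at x)"
proof -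
  have "((\<lambda>y. mU 1 y * PL 2 y + mL 1 y * PU 2 y) has_real_derivative
      (mU 2 x * PL 2 x + PL 1 x * mU 1 x) + (mL 2 x * PU 2 x + - PU 1 x * mL 1 x)) (at x)"
    using m1 DERIV_P2[OF x fin] by (intro DERIV_add DERIV_mult)
  also have "(mU 2 x * PL 2 x + PL 1 x * mU 1 x) + (mL 2 x * PU 2 x + - PU 1 x * mL 1 x)
      = mU 2 x * PL 2 x + mL 2 x * PU 2 x - 1 / w x"
    using m1_relation[OF x m0[OF x]] by (simp add: mult.commute)
  finally show ?thesis
    by (rule has_field_derivative_transform_within_open[OF _ open_pieces x])
      (use DERIV_imp_deriv[OF DERIV_stein_tau[OF _ Z fin m0]] in auto)
qed

section \<open>Kernel representations\<close>

lemma stein_solution_kernel: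
  assumes x: "x \<in> pieces m e" and h: "integrable (density lborel (\<lambda>x. ennreal (p x))) h"
  shows "integrable M (\<lambda>\<omega>. K 0 0 x (Z \<omega>) * h (Z \<omega>))"
    "stein_solution M Z l p w h x = (LINT \<omega>|M. K 0 0 x (Z \<omega>) * h (Z \<omega>))"
proof -
  note h' = density_integrable[OF h]
  note sp = split_at[OF x h'(1,2)]
  show int: "integrable M (\<lambda>\<omega>. K 0 0 x (Z \<omega>) * h (Z \<omega>))"
    using sp(1,2) unfolding K_integrable_iff[OF x h'(1)] P0 by blast
  show "stein_solution M Z l p w h x = (LINT \<omega>|M. K 0 0 x (Z \<omega>) * h (Z \<omega>))"
    unfolding K_expectation[OF x h'(1) int] stein_solution_eq[OF x h] by simp
qed

text \<open>Tail integrals of a constant \<open>c\<close> are \<open>c * PL 1 x\<close> and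
  \<open>c * PU 1 x\<close>; centering at \<open>h x\<close> therefore gives exactly the differences
  in \<open>stein_deriv\<close>.\<close>

lemma stein_deriv_kernel:
  assumes x: "x \<in> pieces m e" and h: "integrable (density lborel (\<lambda>x. ennreal (p x))) h"
    and m: "(mU 0 has_real_derivative mU 1 x) (at x)" "(mL 0 has_real_derivative mL 1 x) (at x)"
  shows "integrable M (\<lambda>\<omega>. K 1 0 x (Z \<omega>) * (h (Z \<omega>) - c))"
    "(LINT \<omega>|M. K 1 0 x (Z \<omega>) * (h (Z \<omega>) - h x)) = stein_deriv h 1 x"
proof -
  have const: "integrable (density lborel (\<lambda>x. ennreal (p x))) (\<lambda>_. c)" for c :: real
    using p_integrable p_nonneg by (subst integrable_real_density) auto
  have hc: "integrable (density lborel (\<lambda>x. ennreal (p x))) (\<lambda>v. h v - c)" for c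
    using h const by (rule Bochner_Integration.integrable_diff)
  note sp = split_at[OF x density_integrable(1,2)[OF hc]]
  show int: "integrable M (\<lambda>\<omega>. K 1 0 x (Z \<omega>) * (h (Z \<omega>) - c))" for c
    using sp(1,2)[of c] unfolding K_integrable_iff[OF x density_integrable(1)[OF hc[of c]]] P0 by blast
  note sph = split_at[OF x density_integrable(1,2)[OF h]] and spc = split_at[OF x density_integrable(1,2)[OF const]]
  have diff: "L 0 (\<lambda>v. h v - c) x = L 0 h x - L 0 (\<lambda>_. c) x" "U 0 (\<lambda>v. h v - c) x = U 0 h x - U 0 (\<lambda>_. c) x" for c
    using sph(1,2) spc(1,2)[of c] unfolding L_def U_def P0 right_diff_distrib
    by (auto intro: set_integral_diff(2))
  have c: "L 0 (\<lambda>_. c) x = c * PL 1 x" "U 0 (\<lambda>_. c) x = c * PU 1 x" for c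
    using PL_Suc(2)[of 0 x] PU_Suc(2)[of 0 x] lower_Ps_finite[of 1] upper_Ps_finite[of 1]
    by (simp_all add: L_def U_def p_nonneg)
  show "(LINT \<omega>|M. K 1 0 x (Z \<omega>) * (h (Z \<omega>) - h x)) = stein_deriv h 1 x"
    unfolding K_expectation[OF x density_integrable(1)[OF hc] int] diff c stein_deriv_def by simp
qed

text \<open>The test function 1 turns the first-order tail integrals into \<open>PL 2\<close> and
  \<open>PU 2\<close>. This evaluates the effect of centering at a constant.\<close>

lemma K21_const:
  assumes x: "x \<in> pieces m e"
    and fin: "lower_Ps l p 2 x < \<infinity>" "upper_Ps u p 2 x < \<infinity>"
  shows "integrable M (\<lambda>\<omega>. K 2 1 x (Z \<omega>))"
    "(LINT \<omega>|M. K 2 1 x (Z \<omega>)) = - (mU 2 x * PL 2 x + mL 2 x * PU 2 x)"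
proof -
  have fin': "lower_Ps l p (Suc 1) x < \<infinity>" "upper_Ps u p (Suc 1) x < \<infinity>"
    using fin by (simp_all only: Suc_1)
  note PL2 = PL_Suc[OF order_refl fin'(1), unfolded Suc_1] and PU2 = PU_Suc[OF order_refl fin'(2), unfolded Suc_1]
  have int: "integrable M (\<lambda>\<omega>. K 2 1 x (Z \<omega>) * (\<lambda>_. 1) (Z \<omega>))"
    using PL2(1) PU2(1) by (subst K_integrable_iff[OF x]) auto
  then show "integrable M (\<lambda>\<omega>. K 2 1 x (Z \<omega>))" by simp
  show "(LINT \<omega>|M. K 2 1 x (Z \<omega>)) = - (mU 2 x * PL 2 x + mL 2 x * PU 2 x)"
    using K_expectation[OF x _ int] PL2(2) PU2(2) by (simp add: L_def U_def)
qed

lemma kernel_hyp_deriv0: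
  assumes "kernel_hyp M Z m e p w i j g" "x \<in> pieces m e"
  shows "(mU 0 has_real_derivative mU 1 x) (at x)" "(mL 0 has_real_derivative mL 1 x) (at x)"
  using kernel_hypD(3,4)[OF assms, of 0] unfolding One_nat_def by simp_all

lemma kernel_hyp_deriv1:
  assumes "kernel_hyp M Z m e p w 1 j g" "x \<in> pieces m e"
  shows "(mU 1 has_real_derivative mU 2 x) (at x)" "(mL 1 has_real_derivative mL 2 x) (at x)"
  using kernel_hypD(3,4)[OF assms, of 1] unfolding Suc_1 by simp_all

lemma kernel_hyp_finite2:
  assumes "kernel_hyp M Z m e p w i 1 g" "x \<in> pieces m e"
  shows "lower_Ps l p 2 x < \<infinity> \<and> upper_Ps u p 2 x < \<infinity>"
  using kernel_hypD(1,2)[OF assms] unfolding Suc_1 by simp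

lemma kernel_hyp_continuous:
  assumes "kernel_hyp M Z m e p w i j g" "x \<in> pieces m e"
  shows "continuous_on UNIV g"
  using loc_abs_continuous_imp_continuous[OF open_UNIV kernel_hypD(5)[OF assms]] .

section \<open>The identities for a fixed test function\<close>

context
  fixes h :: "real \<Rightarrow> real"
  assumes h: "integrable (density lborel (\<lambda>x. ennreal (p x))) h"
    and H00: "kernel_hyp M Z m e p w 0 0 h"
begin

text \<open>Integration by parts leaves terms with \<open>h x\<close> that cancel because
  \<open>mU 0 x * PL 1 x = mL 0 x * PU 1 x\<close>.\<close>

lemma stein_solution_kernel_deriv:
  assumes x: "x \<in> pieces m e"
  shows "integrable M (\<lambda>\<omega>. K 0 1 x (Z \<omega>) * deriv h (Z \<omega>))"
    "stein_solution M Z l p w h x = (LINT \<omega>|M. K 0 1 x (Z \<omega>) * deriv h (Z \<omega>))"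
proof -
  show int: "integrable M (\<lambda>\<omega>. K 0 1 x (Z \<omega>) * deriv h (Z \<omega>))"
    using kernel_hypD(7)[OF H00 x] unfolding One_nat_def .
  show "stein_solution M Z l p w h x = (LINT \<omega>|M. K 0 1 x (Z \<omega>) * deriv h (Z \<omega>))"
    unfolding K_deriv_expectation[OF x kernel_hypD(5)[OF H00 x] int] stein_solution_eq[OF x h]
    using arg_cong[OF m0_relations(1)[OF x], of "\<lambda>c. c * h x"]
    by (simp only: algebra_simps)
qed

lemma DERIV_stein_solution':
  "x \<in> pieces m e \<Longrightarrow> (stein_solution M Z l p w h has_real_derivative stein_deriv h 1 x) (at x)"
  by (intro DERIV_stein_solution h kernel_hyp_continuous[OF H00] kernel_hyp_deriv0[OF H00])

lemma stein_deriv_kernel_centered: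
  assumes x: "x \<in> pieces m e"
  shows "integrable M (\<lambda>\<omega>. K 1 0 x (Z \<omega>) * (h (Z \<omega>) - h x))"
    "(stein_solution M Z l p w h has_real_derivative (LINT \<omega>|M. K 1 0 x (Z \<omega>) * (h (Z \<omega>) - h x))) (at x)"
  using stein_deriv_kernel[OF x h kernel_hyp_deriv0[OF H00 x]] DERIV_stein_solution'[OF x] by simp_all

lemma stein_deriv_kernel_deriv:
  assumes x: "x \<in> pieces m e" and H10: "kernel_hyp M Z m e p w 1 0 h"
  shows "integrable M (\<lambda>\<omega>. K 1 1 x (Z \<omega>) * deriv h (Z \<omega>))"
    "(stein_solution M Z l p w h has_real_derivative (LINT \<omega>|M. K 1 1 x (Z \<omega>) * deriv h (Z \<omega>))) (at x)"
proof -
  show int: "integrable M (\<lambda>\<omega>. K 1 1 x (Z \<omega>) * deriv h (Z \<omega>))"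
    using kernel_hypD(7)[OF H10 x] unfolding One_nat_def .
  show "(stein_solution M Z l p w h has_real_derivative (LINT \<omega>|M. K 1 1 x (Z \<omega>) * deriv h (Z \<omega>))) (at x)"
    unfolding K_deriv_expectation[OF x kernel_hypD(5)[OF H00 x] int] stein_deriv_def[symmetric]
    by (rule DERIV_stein_solution'[OF x])
qed

section \<open>Identities with a regular derivative of the test function\<close>

context
  assumes H11: "kernel_hyp M Z m e p w 1 1 (deriv h)" and Z_integrable: "integrable M Z"
begin

text \<open>The kernel hypotheses are quantified over the points of the pieces; the point
  \<open>x\<close> gives access to their global statements about \<open>h\<close>, valid at every
  \<open>y\<close>.\<close>

lemma deriv_h_density:
  assumes x: "x \<in> pieces m e"
  shows "is_density_of (deriv h) h" "(h has_real_derivative deriv h y) (at y)"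
  using continuous_deriv_is_density[OF kernel_hypD(5)[OF H00 x] kernel_hyp_continuous[OF H11 x]] by auto

lemma DERIV_stein_tau':
  "x \<in> pieces m e \<Longrightarrow>
    ((\<lambda>y. stein_tau M Z l p y / w y) has_real_derivative mU 1 x * PL 2 x + mL 1 x * PU 2 x) (at x)"
  by (intro DERIV_stein_tau Z_integrable kernel_hyp_finite2[OF H11] kernel_hyp_deriv0[OF H00])

lemma DERIV_deriv_stein_tau':
  "x \<in> pieces m e \<Longrightarrow> (deriv (\<lambda>y. stein_tau M Z l p y / w y)
    has_real_derivative mU 2 x * PL 2 x + mL 2 x * PU 2 x - 1 / w x) (at x)"
  by (intro DERIV_deriv_stein_tau Z_integrable kernel_hyp_finite2[OF H11] kernel_hyp_deriv0[OF H00] kernel_hyp_deriv1[OF H11])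

lemma DERIV_deriv_stein_solution:
  assumes x: "x \<in> pieces m e"
  shows "(deriv (stein_solution M Z l p w h) has_real_derivative stein_deriv h 2 x + 1 / w x * deriv h x) (at x)"
  using DERIV_stein_deriv[OF x h kernel_hyp_continuous[OF H00 x] deriv_h_density(2)[OF x]
    kernel_hyp_deriv0[OF H00 x] kernel_hyp_deriv1[OF H11 x]]
  by (rule has_field_derivative_transform_within_open[OF _ open_pieces x])
    (use DERIV_imp_deriv[OF DERIV_stein_solution'] in auto)

lemma K_deriv_deriv:
  assumes x: "x \<in> pieces m e" and int: "integrable M (\<lambda>\<omega>. K i 2 x (Z \<omega>) * deriv (deriv h) (Z \<omega>))"
  shows "(LINT \<omega>|M. K i 2 x (Z \<omega>) * deriv (deriv h) (Z \<omega>)) =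
    stein_deriv h i x + (mU i x * PL 2 x + mL i x * PU 2 x) * deriv h x"
  using K_deriv2_expectation[OF x kernel_hypD(5)[OF H11 x] deriv_h_density(1)[OF x] _ _ int]
    kernel_hyp_finite2[OF H11 x]
  by (simp only: stein_deriv_def)

lemma stein_deriv_kernel_deriv2:
  assumes x: "x \<in> pieces m e"
  shows "integrable M (\<lambda>\<omega>. K 1 2 x (Z \<omega>) * deriv (deriv h) (Z \<omega>))"
    "(\<lambda>y. stein_tau M Z l p y / w y) differentiable (at x)"
    "(stein_solution M Z l p w h has_real_derivative
      (LINT \<omega>|M. K 1 2 x (Z \<omega>) * deriv (deriv h) (Z \<omega>))
        - deriv (\<lambda>y. stein_tau M Z l p y / w y) x * deriv h x) (at x)"
proof -
  show int: "integrable M (\<lambda>\<omega>. K 1 2 x (Z \<omega>) * deriv (deriv h) (Z \<omega>))"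
    using kernel_hypD(7)[OF H11 x] unfolding Suc_1 .
  show "(\<lambda>y. stein_tau M Z l p y / w y) differentiable (at x)"
    using DERIV_stein_tau'[OF x] real_differentiable_def by blast
  show "(stein_solution M Z l p w h has_real_derivative
      (LINT \<omega>|M. K 1 2 x (Z \<omega>) * deriv (deriv h) (Z \<omega>))
        - deriv (\<lambda>y. stein_tau M Z l p y / w y) x * deriv h x) (at x)"
    unfolding K_deriv_deriv[OF x int] DERIV_imp_deriv[OF DERIV_stein_tau'[OF x]]
    using DERIV_stein_solution'[OF x] by (simp only: add_diff_cancel_right')
qed

lemma K21_expectation:
  assumes x: "x \<in> pieces m e"
  shows "integrable M (\<lambda>\<omega>. K 2 1 x (Z \<omega>) * deriv h (Z \<omega>))"
    "(LINT \<omega>|M. K 2 1 x (Z \<omega>) * deriv h (Z \<omega>)) = stein_deriv h 2 x"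
proof -
  show int: "integrable M (\<lambda>\<omega>. K 2 1 x (Z \<omega>) * deriv h (Z \<omega>))"
    using kernel_hypD(8)[OF H11 x] unfolding Suc_1 .
  show "(LINT \<omega>|M. K 2 1 x (Z \<omega>) * deriv h (Z \<omega>)) = stein_deriv h 2 x"
    using K_deriv_expectation[OF x kernel_hypD(5)[OF H00 x] int] by (simp only: stein_deriv_def)
qed

lemma stein_deriv2_kernel_deriv:
  assumes x: "x \<in> pieces m e"
  shows "(deriv (stein_solution M Z l p w h) has_real_derivative
    (LINT \<omega>|M. K 2 1 x (Z \<omega>) * deriv h (Z \<omega>)) + 1 / w x * deriv h x) (at x)"
  unfolding K21_expectation(2)[OF x] by (rule DERIV_deriv_stein_solution[OF x])

text \<open>The expectation exceeds \<open>stein_deriv h 2 x\<close> by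
  \<open>(mU 2 x * PL 2 x + mL 2 x * PU 2 x) * deriv h x\<close>. Subtracting the second derivative
  of \<open>stein_tau / w\<close> times \<open>deriv h x\<close> removes this and leaves
  \<open>1 / w x * deriv h x\<close>.\<close>

lemma stein_deriv2_kernel_deriv2:
  assumes x: "x \<in> pieces m e" and H21: "kernel_hyp M Z m e p w 2 1 (deriv h)"
  shows "integrable M (\<lambda>\<omega>. K 2 2 x (Z \<omega>) * deriv (deriv h) (Z \<omega>))"
    "deriv (\<lambda>y. stein_tau M Z l p y / w y) differentiable (at x)"
    "(deriv (stein_solution M Z l p w h) has_real_derivative
      (LINT \<omega>|M. K 2 2 x (Z \<omega>) * deriv (deriv h) (Z \<omega>))
        - deriv (deriv (\<lambda>y. stein_tau M Z l p y / w y)) x * deriv h x) (at x)"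
proof -
  show int: "integrable M (\<lambda>\<omega>. K 2 2 x (Z \<omega>) * deriv (deriv h) (Z \<omega>))"
    using kernel_hypD(7)[OF H21 x] unfolding Suc_1 .
  show "deriv (\<lambda>y. stein_tau M Z l p y / w y) differentiable (at x)"
    using DERIV_deriv_stein_tau'[OF x] real_differentiable_def by blast
  show "(deriv (stein_solution M Z l p w h) has_real_derivative
      (LINT \<omega>|M. K 2 2 x (Z \<omega>) * deriv (deriv h) (Z \<omega>))
        - deriv (deriv (\<lambda>y. stein_tau M Z l p y / w y)) x * deriv h x) (at x)"
    unfolding K_deriv_deriv[OF x int] DERIV_imp_deriv[OF DERIV_deriv_stein_tau'[OF x]]
    by (rule DERIV_cong[OF DERIV_deriv_stein_solution[OF x]]) (simp only: algebra_simps)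
qed

text \<open>By \<open>K21_const\<close>, centering adds
  \<open>(mU 2 x * PL 2 x + mL 2 x * PU 2 x) * deriv h x\<close>, the same amount as in
  \<open>K_deriv_deriv\<close> for \<open>i = 2\<close>.\<close>

lemma stein_deriv2_kernel_centered:
  assumes x: "x \<in> pieces m e"
  shows "integrable M (\<lambda>\<omega>. K 2 1 x (Z \<omega>) * (deriv h (Z \<omega>) - deriv h x))"
    "(deriv (stein_solution M Z l p w h) has_real_derivative
      (LINT \<omega>|M. K 2 1 x (Z \<omega>) * (deriv h (Z \<omega>) - deriv h x))
        - deriv (deriv (\<lambda>y. stein_tau M Z l p y / w y)) x * deriv h x) (at x)"
proof -
  note K21 = K21_const[OF x conjunct1[OF kernel_hyp_finite2[OF H11 x]] conjunct2[OF kernel_hyp_finite2[OF H11 x]]]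
  have c: "integrable M (\<lambda>\<omega>. K 2 1 x (Z \<omega>) * deriv h x)"
    using K21(1) by simp
  note diff = Bochner_Integration.integrable_diff[OF K21_expectation(1)[OF x] c]
    Bochner_Integration.integral_diff[OF K21_expectation(1)[OF x] c]
  show "integrable M (\<lambda>\<omega>. K 2 1 x (Z \<omega>) * (deriv h (Z \<omega>) - deriv h x))"
    using diff(1) by (simp only: right_diff_distrib)
  have "(LINT \<omega>|M. K 2 1 x (Z \<omega>) * (deriv h (Z \<omega>) - deriv h x)) =
      stein_deriv h 2 x + (mU 2 x * PL 2 x + mL 2 x * PU 2 x) * deriv h x"
    unfolding right_diff_distrib diff(2) K21_expectation(2)[OF x] integral_mult_left_zero K21(2)
    by (simp only: mult_minus_left diff_minus_eq_add)
  then show "(deriv (stein_solution M Z l p w h) has_real_derivative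
      (LINT \<omega>|M. K 2 1 x (Z \<omega>) * (deriv h (Z \<omega>) - deriv h x))
        - deriv (deriv (\<lambda>y. stein_tau M Z l p y / w y)) x * deriv h x) (at x)"
    unfolding DERIV_imp_deriv[OF DERIV_deriv_stein_tau'[OF x]]
    by (intro DERIV_cong[OF DERIV_deriv_stein_solution[OF x]]) (simp only: algebra_simps)
qed

end

end

end

theorem theorem2p20:
  fixes M :: "'a measure" and Z :: "'a \<Rightarrow> real"
    and p w h :: "real \<Rightarrow> real"
    and m :: nat and e :: "nat \<Rightarrow> ereal" and l u :: ereal
  assumes "prob_space M"
    and "\<forall>x. 0 \<le> p x"
    and "distributed M lborel Z (\<lambda>x. ennreal (p x))"
    and "m \<ge> 1"
    and "l = e 0" and "u = e m"
    and "\<forall>r\<in>{1..m}. e (r - 1) < e r"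
    and "{x. p x > 0} = pieces m e"
    and "\<forall>r\<in>{1..m}. locally_abs_continuous_on (einterval (e (r - 1)) (e r)) p"
    and "\<forall>x\<in>pieces m e. w x \<noteq> 0"
    and "\<forall>r\<in>{1..m}. locally_abs_continuous_on (einterval (e (r - 1)) (e r)) (\<lambda>x. w x * p x)"
    and "integrable M Z"
    and "integrable (density lborel (\<lambda>x. ennreal (p x))) h"
  shows "\<forall>x\<in>pieces m e.
    \<comment> \<open>(1)\<close>
    (integrable M (\<lambda>\<omega>. K_kernel l u p w 0 0 x (Z \<omega>) * h (Z \<omega>)) \<and>
     stein_solution M Z l p w h x = (LINT \<omega>|M. K_kernel l u p w 0 0 x (Z \<omega>) * h (Z \<omega>))) \<and>
    (kernel_hyp M Z m e p w 0 0 h \<longrightarrow>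
      \<comment> \<open>(2)\<close>
      (integrable M (\<lambda>\<omega>. K_kernel l u p w 0 1 x (Z \<omega>) * deriv h (Z \<omega>)) \<and>
       stein_solution M Z l p w h x =
         (LINT \<omega>|M. K_kernel l u p w 0 1 x (Z \<omega>) * deriv h (Z \<omega>))) \<and>
      \<comment> \<open>(3)\<close>
      (integrable M (\<lambda>\<omega>. K_kernel l u p w 1 0 x (Z \<omega>) * (h (Z \<omega>) - h x)) \<and>
       (stein_solution M Z l p w h has_real_derivative
         (LINT \<omega>|M. K_kernel l u p w 1 0 x (Z \<omega>) * (h (Z \<omega>) - h x))) (at x))) \<and>
    (kernel_hyp M Z m e p w 0 0 h \<and> kernel_hyp M Z m e p w 1 0 h \<longrightarrow>
      \<comment> \<open>(4)\<close>
      (integrable M (\<lambda>\<omega>. K_kernel l u p w 1 1 x (Z \<omega>) * deriv h (Z \<omega>)) \<and>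
       (stein_solution M Z l p w h has_real_derivative
         (LINT \<omega>|M. K_kernel l u p w 1 1 x (Z \<omega>) * deriv h (Z \<omega>))) (at x))) \<and>
    (kernel_hyp M Z m e p w 0 0 h \<and> kernel_hyp M Z m e p w 1 0 h \<and>
     kernel_hyp M Z m e p w 1 1 (deriv h) \<longrightarrow>
      \<comment> \<open>(5)\<close>
      (integrable M (\<lambda>\<omega>. K_kernel l u p w 1 2 x (Z \<omega>) * deriv (deriv h) (Z \<omega>)) \<and>
       (\<lambda>y. stein_tau M Z l p y / w y) differentiable (at x) \<and>
       (stein_solution M Z l p w h has_real_derivative
         (LINT \<omega>|M. K_kernel l u p w 1 2 x (Z \<omega>) * deriv (deriv h) (Z \<omega>))
           - deriv (\<lambda>y. stein_tau M Z l p y / w y) x * deriv h x) (at x)) \<and>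
      \<comment> \<open>(6)\<close>
      (integrable M (\<lambda>\<omega>. K_kernel l u p w 2 1 x (Z \<omega>) * deriv h (Z \<omega>)) \<and>
       (deriv (stein_solution M Z l p w h) has_real_derivative
         (LINT \<omega>|M. K_kernel l u p w 2 1 x (Z \<omega>) * deriv h (Z \<omega>)) + 1 / w x * deriv h x) (at x))) \<and>
    (kernel_hyp M Z m e p w 0 0 h \<and> kernel_hyp M Z m e p w 1 0 h \<and>
     kernel_hyp M Z m e p w 1 1 (deriv h) \<and> kernel_hyp M Z m e p w 2 1 (deriv h) \<longrightarrow>
      \<comment> \<open>(7)\<close>
      (integrable M (\<lambda>\<omega>. K_kernel l u p w 2 2 x (Z \<omega>) * deriv (deriv h) (Z \<omega>)) \<and>
       deriv (\<lambda>y. stein_tau M Z l p y / w y) differentiable (at x) \<and>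
       (deriv (stein_solution M Z l p w h) has_real_derivative
         (LINT \<omega>|M. K_kernel l u p w 2 2 x (Z \<omega>) * deriv (deriv h) (Z \<omega>))
           - deriv (deriv (\<lambda>y. stein_tau M Z l p y / w y)) x * deriv h x) (at x)) \<and>
      \<comment> \<open>(8)\<close>
      (integrable M (\<lambda>\<omega>. K_kernel l u p w 2 1 x (Z \<omega>) * (deriv h (Z \<omega>) - deriv h x)) \<and>
       (deriv (stein_solution M Z l p w h) has_real_derivative
         (LINT \<omega>|M. K_kernel l u p w 2 1 x (Z \<omega>) * (deriv h (Z \<omega>) - deriv h x))
           - deriv (deriv (\<lambda>y. stein_tau M Z l p y / w y)) x * deriv h x) (at x)))"
proof -
  interpret prob_space M by fact
  interpret stein_setting M Z p w m e l u
    by (intro stein_setting.intro stein_setting_axioms.intro) (fact assms | rule assms(2)[rule_format])+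
  show ?thesis
  proof (intro ballI, goal_cases)
    case x: (1 x)
    \<comment> \<open>Each conjunct is an instance of one kernel representation. Its side conditions
      are the kernel hypotheses of the respective implication and the integrability of
      \<open>Z\<close> and \<open>h\<close>.\<close>
    show ?case
      by (intro conjI impI; (elim conjE)?;
        (rule stein_solution_kernel[where h=h] stein_solution_kernel_deriv[where h=h]
          stein_deriv_kernel_centered[where h=h] stein_deriv_kernel_deriv[where h=h]
          stein_deriv_kernel_deriv2[where h=h] K21_expectation(1)[where h=h]
          stein_deriv2_kernel_deriv[where h=h] stein_deriv2_kernel_deriv2[where h=h]
          stein_deriv2_kernel_centered[where h=h];
         (assumption | rule x assms(12,13))))
  qed
qed

end
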